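(* Let $(\mathcal{A}', \mathcal{A}, \mathcal{A}'', i^{*}, i_{*}, i^{!}, j_{!}, j^{*}, j_{*})$ be a recollement of abelian categories and let $\mathcal{C}$ be a wide subcategory of $\mathcal{A}$. If $i_{*}(\mathcal{A}')\subset\mathcal{C}$, then the given recollement restricts to a recollement of wide subcategories $(\mathcal{A}', \mathcal{C}, j^{*}(\mathcal{C}), \overline{i^{*}}, \overline{i_{*}}, \overline{i^{!}}, \overline{j_{!}}, \overline{j^{*}}, \overline{j_{*}})$, where $\mathcal{A}'$, $\mathcal{C}$, $j^{*}(\mathcal{C})$ are wide subcategories of $\mathcal{A}'$, $\mathcal{A}$, $\mathcal{A}''$ respectively, and $\overline{i_{*}}:\mathcal{A}'\to\mathcal{C}$, $\overline{i^{*}},\overline{i^{!}}:\mathcal{C}\to\mathcal{A}'$, $\overline{j^{*}}:\mathcal{C}\to j^{*}(\mathcal{C})$, $\overline{j_{!}},\overline{j_{*}}:j^{*}(\mathcal{C})\to\mathcal{C}$ are the restrictions of $i_{*}, i^{*}, i^{!}, j^{*}, j_{!}, j_{*}$.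
   Context: A recollement $(\mathcal{A}', \mathcal{A}, \mathcal{A}'', i^{*}, i_{*}, i^{!}, j_{!}, j^{*}, j_{*})$ of an abelian category $\mathcal{A}$ relative to abelian categories $\mathcal{A}'$ and $\mathcal{A}''$ consists of functors $i_{*}:\mathcal{A}'\to\mathcal{A}$, $i^{*}, i^{!}:\mathcal{A}\to\mathcal{A}'$, $j^{*}:\mathcal{A}\to\mathcal{A}''$, $j_{!}, j_{*}:\mathcal{A}''\to\mathcal{A}$ such that: (1) $(i^{*}, i_{*})$, $(i_{*}, i^{!})$, $(j_{!}, j^{*})$ and $(j^{*}, j_{*})$ are adjoint pairs (left adjoint written first); (2) $i_{*}, j_{!}, j_{*}$ are fully faithful; (3) $\mathrm{Im}\, i_{*}=\mathrm{Ker}\, j^{*}$, where $\mathrm{Im}$ is the essential image and $\mathrm{Ker}\,j^{*}$ is the full subcategory of objects $X$ with $j^{*}(X)\cong 0$. A full subcategory $\mathcal{C}$ of an abelian category $\mathcal{B}$ is called wide if it is nonempty (equivalently, given the other conditions, contains the zero objects), is closed under kernels and cokernels (for every morphism $f$ of $\mathcal{C}$, its kernel and cokernel in $\mathcal{B}$ lie in $\mathcal{C}$), and is closed under extensions (if $0\to M\to N\to P\to 0$ is exact in $\mathcal{B}$ with $M,P\in\mathcal{C}$, then $N\in\mathcal{C}$). In particular a wide subcategory is closed under isomorphisms, and is itself an abelian category. For a functor $F$ and a full subcategory $\mathcal{C}$ of its source, $F(\mathcal{C})$ denotes the full subcategory of the target consisting of all objects isomorphic to $F(C)$ for some $C\in\mathcal{C}$.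 *)

theory Defs
  imports "HOL-Algebra.Group" "HOL-Library.FuncSet"
begin

section \<open>Categories and functors\<close>

text \<open>\<open>Comp C g f\<close> is the composite \<open>g \<circ> f\<close>; it is meaningful only if \<open>Cod C f = Dom C g\<close>.\<close>

record ('o, 'a) cat =
  Obj :: "'o set"
  Arr :: "'a set"
  Dom :: "'a \<Rightarrow> 'o"
  Cod :: "'a \<Rightarrow> 'o"
  Id :: "'o \<Rightarrow> 'a"
  Comp :: "'a \<Rightarrow> 'a \<Rightarrow> 'a"

definition Hom :: "('o, 'a, 'm) cat_scheme \<Rightarrow> 'o \<Rightarrow> 'o \<Rightarrow> 'a set" where
  "Hom C x y = {f \<in> Arr C. Dom C f = x \<and> Cod C f = y}"

locale category =
  fixes C :: "('o, 'a, 'm) cat_scheme"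
  assumes dom_obj: "f \<in> Arr C \<Longrightarrow> Dom C f \<in> Obj C"
    and cod_obj: "f \<in> Arr C \<Longrightarrow> Cod C f \<in> Obj C"
    and id_hom: "x \<in> Obj C \<Longrightarrow> Id C x \<in> Hom C x x"
    and comp_hom: "f \<in> Hom C x y \<Longrightarrow> g \<in> Hom C y z \<Longrightarrow> Comp C g f \<in> Hom C x z"
    and comp_id: "f \<in> Hom C x y \<Longrightarrow> Comp C f (Id C x) = f"
    and id_comp: "f \<in> Hom C x y \<Longrightarrow> Comp C (Id C y) f = f"
    and comp_assoc: "f \<in> Hom C w x \<Longrightarrow> g \<in> Hom C x y \<Longrightarrow> h \<in> Hom C y z \<Longrightarrow>
      Comp C h (Comp C g f) = Comp C (Comp C h g) f"

definition isomorphic :: "('o, 'a, 'm) cat_scheme \<Rightarrow> 'o \<Rightarrow> 'o \<Rightarrow> bool" where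
  "isomorphic C x y \<longleftrightarrow> (\<exists>f \<in> Hom C x y. \<exists>g \<in> Hom C y x.
     Comp C g f = Id C x \<and> Comp C f g = Id C y)"

definition zero_object :: "('o, 'a, 'm) cat_scheme \<Rightarrow> 'o \<Rightarrow> bool" where
  "zero_object C z \<longleftrightarrow> z \<in> Obj C \<and>
     (\<forall>x \<in> Obj C. (\<exists>!f. f \<in> Hom C z x) \<and> (\<exists>!f. f \<in> Hom C x z))"

definition monic :: "('o, 'a, 'm) cat_scheme \<Rightarrow> 'a \<Rightarrow> bool" where
  "monic C f \<longleftrightarrow> f \<in> Arr C \<and>
     (\<forall>x. \<forall>u \<in> Hom C x (Dom C f). \<forall>v \<in> Hom C x (Dom C f). Comp C f u = Comp C f v \<longrightarrow> u = v)"

definition epic :: "('o, 'a, 'm) cat_scheme \<Rightarrow> 'a \<Rightarrow> bool" where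
  "epic C f \<longleftrightarrow> f \<in> Arr C \<and>
     (\<forall>x. \<forall>u \<in> Hom C (Cod C f) x. \<forall>v \<in> Hom C (Cod C f) x. Comp C u f = Comp C v f \<longrightarrow> u = v)"

text \<open>Full subcategories of \<open>C\<close> are given by subsets of \<open>Obj C\<close>; all further structure
  (including the addition of arrows introduced below) is inherited.\<close>

definition full_subcat :: "('o, 'a, 'm) cat_scheme \<Rightarrow> 'o set \<Rightarrow> ('o, 'a, 'm) cat_scheme" where
  "full_subcat C S = C\<lparr>Obj := S, Arr := {f \<in> Arr C. Dom C f \<in> S \<and> Cod C f \<in> S}\<rparr>"

record ('o, 'a, 'p, 'b) func =
  FObj :: "'o \<Rightarrow> 'p"
  FArr :: "'a \<Rightarrow> 'b"

definition is_functor ::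
  "('o, 'a, 'm) cat_scheme \<Rightarrow> ('p, 'b, 'n) cat_scheme \<Rightarrow> ('o, 'a, 'p, 'b) func \<Rightarrow> bool" where
  "is_functor C D F \<longleftrightarrow>
     (\<forall>x \<in> Obj C. FObj F x \<in> Obj D) \<and>
     (\<forall>x y. \<forall>f \<in> Hom C x y. FArr F f \<in> Hom D (FObj F x) (FObj F y)) \<and>
     (\<forall>x \<in> Obj C. FArr F (Id C x) = Id D (FObj F x)) \<and>
     (\<forall>x y z. \<forall>f \<in> Hom C x y. \<forall>g \<in> Hom C y z.
        FArr F (Comp C g f) = Comp D (FArr F g) (FArr F f))"

definition restrict_functor ::
  "('o, 'a, 'm) cat_scheme \<Rightarrow> ('o, 'a, 'p, 'b) func \<Rightarrow> ('o, 'a, 'p, 'b) func" where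
  "restrict_functor C F = \<lparr>FObj = restrict (FObj F) (Obj C), FArr = restrict (FArr F) (Arr C)\<rparr>"

definition fully_faithful ::
  "('o, 'a, 'm) cat_scheme \<Rightarrow> ('p, 'b, 'n) cat_scheme \<Rightarrow> ('o, 'a, 'p, 'b) func \<Rightarrow> bool" where
  "fully_faithful C D F \<longleftrightarrow>
     (\<forall>x \<in> Obj C. \<forall>y \<in> Obj C. bij_betw (FArr F) (Hom C x y) (Hom D (FObj F x) (FObj F y)))"

text \<open>\<open>F\<close> is left adjoint to \<open>G\<close>: there are bijections from \<open>Hom D (F x) y\<close> to \<open>Hom C x (G y)\<close>,
  natural in \<open>x\<close> and \<open>y\<close>.\<close>

definition adjoint_pair ::
  "('o, 'a, 'm) cat_scheme \<Rightarrow> ('p, 'b, 'n) cat_scheme \<Rightarrow>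
   ('o, 'a, 'p, 'b) func \<Rightarrow> ('p, 'b, 'o, 'a) func \<Rightarrow> bool" where
  "adjoint_pair C D F G \<longleftrightarrow> is_functor C D F \<and> is_functor D C G \<and>
     (\<exists>\<phi>. (\<forall>x \<in> Obj C. \<forall>y \<in> Obj D.
             bij_betw (\<phi> x y) (Hom D (FObj F x) y) (Hom C x (FObj G y))) \<and>
          (\<forall>x' x y y'. \<forall>f \<in> Hom C x' x. \<forall>g \<in> Hom D y y'. \<forall>h \<in> Hom D (FObj F x) y.
             \<phi> x' y' (Comp D g (Comp D h (FArr F f))) = Comp C (FArr G g) (Comp C (\<phi> x y h) f)))"

text \<open>The object set of \<open>F(S)\<close>, closed under isomorphism in the target \<open>D\<close>; for
  \<open>S = Obj C\<close> this is the essential image of \<open>F\<close>.\<close>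

definition ess_image ::
  "('p, 'b, 'n) cat_scheme \<Rightarrow> ('o, 'a, 'p, 'b) func \<Rightarrow> 'o set \<Rightarrow> 'p set" where
  "ess_image D F S = {y \<in> Obj D. \<exists>x \<in> S. isomorphic D y (FObj F x)}"

definition ker_functor ::
  "('o, 'a, 'm) cat_scheme \<Rightarrow> ('p, 'b, 'n) cat_scheme \<Rightarrow> ('o, 'a, 'p, 'b) func \<Rightarrow> 'o set" where
  "ker_functor C D F = {x \<in> Obj C. \<exists>z. zero_object D z \<and> isomorphic D (FObj F x) z}"

section \<open>Abelian categories\<close>

record ('o, 'a) ab_cat = "('o, 'a) cat" +
  Add :: "'a \<Rightarrow> 'a \<Rightarrow> 'a"
  Zero :: "'o \<Rightarrow> 'o \<Rightarrow> 'a"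

locale preadditive = category C
  for C :: "('o, 'a, 'm) ab_cat_scheme" +
  assumes hom_group: "x \<in> Obj C \<Longrightarrow> y \<in> Obj C \<Longrightarrow>
      comm_group \<lparr>carrier = Hom C x y, mult = Add C, one = Zero C x y\<rparr>"
    and comp_add: "f \<in> Hom C x y \<Longrightarrow> g \<in> Hom C x y \<Longrightarrow> h \<in> Hom C y z \<Longrightarrow>
      Comp C h (Add C f g) = Add C (Comp C h f) (Comp C h g)"
    and add_comp: "f \<in> Hom C x y \<Longrightarrow> g \<in> Hom C y z \<Longrightarrow> h \<in> Hom C y z \<Longrightarrow>
      Comp C (Add C g h) f = Add C (Comp C g f) (Comp C h f)"

definition is_kernel :: "('o, 'a, 'm) ab_cat_scheme \<Rightarrow> 'a \<Rightarrow> 'a \<Rightarrow> bool" where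
  "is_kernel C f k \<longleftrightarrow> f \<in> Arr C \<and> k \<in> Arr C \<and> Cod C k = Dom C f \<and>
     Comp C f k = Zero C (Dom C k) (Cod C f) \<and>
     (\<forall>x. \<forall>h \<in> Hom C x (Dom C f). Comp C f h = Zero C x (Cod C f) \<longrightarrow>
        (\<exists>!u. u \<in> Hom C x (Dom C k) \<and> Comp C k u = h))"

definition is_cokernel :: "('o, 'a, 'm) ab_cat_scheme \<Rightarrow> 'a \<Rightarrow> 'a \<Rightarrow> bool" where
  "is_cokernel C f c \<longleftrightarrow> f \<in> Arr C \<and> c \<in> Arr C \<and> Dom C c = Cod C f \<and>
     Comp C c f = Zero C (Dom C f) (Cod C c) \<and>
     (\<forall>x. \<forall>h \<in> Hom C (Cod C f) x. Comp C h f = Zero C (Dom C f) x \<longrightarrow>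
        (\<exists>!u. u \<in> Hom C (Cod C c) x \<and> Comp C u c = h))"

definition is_biproduct ::
  "('o, 'a, 'm) ab_cat_scheme \<Rightarrow> 'o \<Rightarrow> 'o \<Rightarrow> 'o \<Rightarrow> 'a \<Rightarrow> 'a \<Rightarrow> 'a \<Rightarrow> 'a \<Rightarrow> bool" where
  "is_biproduct C x y s i1 i2 p1 p2 \<longleftrightarrow>
     i1 \<in> Hom C x s \<and> i2 \<in> Hom C y s \<and> p1 \<in> Hom C s x \<and> p2 \<in> Hom C s y \<and>
     Comp C p1 i1 = Id C x \<and> Comp C p2 i2 = Id C y \<and>
     Add C (Comp C i1 p1) (Comp C i2 p2) = Id C s"

locale abelian_category = preadditive C
  for C :: "('o, 'a, 'm) ab_cat_scheme" +
  assumes ex_zero: "\<exists>z. zero_object C z"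
    and ex_biproduct: "x \<in> Obj C \<Longrightarrow> y \<in> Obj C \<Longrightarrow>
      \<exists>s i1 i2 p1 p2. is_biproduct C x y s i1 i2 p1 p2"
    and ex_kernel: "f \<in> Arr C \<Longrightarrow> \<exists>k. is_kernel C f k"
    and ex_cokernel: "f \<in> Arr C \<Longrightarrow> \<exists>c. is_cokernel C f c"
    and monic_is_kernel: "monic C f \<Longrightarrow> \<exists>g. is_kernel C g f"
    and epic_is_cokernel: "epic C f \<Longrightarrow> \<exists>g. is_cokernel C g f"

text \<open>The image of an arrow is the kernel of its cokernel. Like kernels and cokernels, it is a
  relation because it is determined only up to isomorphism.\<close>

definition is_image :: "('o, 'a, 'm) ab_cat_scheme \<Rightarrow> 'a \<Rightarrow> 'a \<Rightarrow> bool" where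
  "is_image C f m \<longleftrightarrow> (\<exists>c. is_cokernel C f c \<and> is_kernel C c m)"

definition exact_at :: "('o, 'a, 'm) ab_cat_scheme \<Rightarrow> 'a \<Rightarrow> 'a \<Rightarrow> bool" where
  "exact_at C f g \<longleftrightarrow> f \<in> Arr C \<and> g \<in> Arr C \<and> Cod C f = Dom C g \<and>
     (\<exists>m. is_image C f m \<and> is_kernel C g m)"

definition short_exact :: "('o, 'a, 'm) ab_cat_scheme \<Rightarrow> 'a \<Rightarrow> 'a \<Rightarrow> bool" where
  "short_exact C f g \<longleftrightarrow> (\<exists>z. zero_object C z \<and>
     exact_at C (Zero C z (Dom C f)) f \<and> exact_at C f g \<and> exact_at C g (Zero C (Cod C g) z))"

definition wide_subcat :: "('o, 'a, 'm) ab_cat_scheme \<Rightarrow> 'o set \<Rightarrow> bool" where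
  "wide_subcat B S \<longleftrightarrow> abelian_category B \<and> S \<subseteq> Obj B \<and> S \<noteq> {} \<and>
     (\<forall>f k. f \<in> Arr (full_subcat B S) \<and> is_kernel B f k \<longrightarrow> Dom B k \<in> S) \<and>
     (\<forall>f c. f \<in> Arr (full_subcat B S) \<and> is_cokernel B f c \<longrightarrow> Cod B c \<in> S) \<and>
     (\<forall>f g. short_exact B f g \<and> Dom B f \<in> S \<and> Cod B g \<in> S \<longrightarrow> Cod B f \<in> S)"

section \<open>Recollements\<close>

text \<open>The arguments \<open>i_ustar\<close>, \<open>i_lstar\<close>, \<open>i_ushriek\<close>, \<open>j_lshriek\<close>, \<open>j_ustar\<close>, \<open>j_lstar\<close>
  are \<open>i\<^sup>*\<close>, \<open>i\<^sub>*\<close>, \<open>i\<^sup>!\<close>, \<open>j\<^sub>!\<close>, \<open>j\<^sup>*\<close>, \<open>j\<^sub>*\<close> (\<open>u\<close> upper, \<open>l\<close> lower).\<close>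

definition recollement ::
  "('o1, 'a1, 'm1) ab_cat_scheme \<Rightarrow> ('o, 'a, 'm) ab_cat_scheme \<Rightarrow> ('o2, 'a2, 'm2) ab_cat_scheme \<Rightarrow>
   ('o, 'a, 'o1, 'a1) func \<Rightarrow> ('o1, 'a1, 'o, 'a) func \<Rightarrow> ('o, 'a, 'o1, 'a1) func \<Rightarrow>
   ('o2, 'a2, 'o, 'a) func \<Rightarrow> ('o, 'a, 'o2, 'a2) func \<Rightarrow> ('o2, 'a2, 'o, 'a) func \<Rightarrow> bool" where
  "recollement A' A A'' i_ustar i_lstar i_ushriek j_lshriek j_ustar j_lstar \<longleftrightarrow>
     abelian_category A' \<and> abelian_category A \<and> abelian_category A'' \<and>
     adjoint_pair A A' i_ustar i_lstar \<and>
     adjoint_pair A' A i_lstar i_ushriek \<and>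
     adjoint_pair A'' A j_lshriek j_ustar \<and>
     adjoint_pair A A'' j_ustar j_lstar \<and>
     fully_faithful A' A i_lstar \<and>
     fully_faithful A'' A j_lshriek \<and>
     fully_faithful A'' A j_lstar \<and>
     ess_image A i_lstar (Obj A') = ker_functor A A'' j_ustar"

end

theory Submission
  imports Defs
begin

text \<open>
  Write \<open>T\<close> for \<open>j\<^sup>*(S)\<close>. The statement reduces to one fact: for an object \<open>y\<close> of \<open>A''\<close> the
  conditions \<open>y \<in> T\<close>, \<open>j\<^sub>*(y) \<in> S\<close> and \<open>j\<^sub>!(y) \<in> S\<close> are equivalent (lemmas \<open>image_iff_right\<close>
  and \<open>image_iff_left\<close>). For \<open>x \<in> S\<close> the unit \<open>x \<rightarrow> j\<^sub>*(j\<^sup>*(x))\<close> becomes invertible under the exact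
  functor \<open>j\<^sup>*\<close>, because \<open>j\<^sub>*\<close> is fully faithful. Its kernel and cokernel are therefore killed by
  \<open>j\<^sup>*\<close>, so they come from \<open>A'\<close> and lie in \<open>S\<close>. An arrow whose kernel and cokernel lie in a wide
  subcategory has its source there exactly if it has its target there (\<open>dom_mem_if_cod_mem\<close>,
  \<open>cod_mem_if_dom_mem\<close>); hence \<open>j\<^sub>*(j\<^sup>*(x)) \<in> S\<close>. The case of \<open>j\<^sub>!\<close> is dual.

  That \<open>T\<close> is wide now follows by transport along \<open>j\<^sub>*\<close> and \<open>j\<^sub>!\<close>. The right adjoint \<open>j\<^sub>*\<close> preserves
  kernels, so \<open>T\<close> is closed under kernels, and dually \<open>j\<^sub>!\<close> handles cokernels. For an extension
  \<open>0 \<rightarrow> M \<rightarrow> N \<rightarrow> P \<rightarrow> 0\<close> the functor \<open>j\<^sub>*\<close> is only left exact, but the cokernel of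
  \<open>j\<^sub>*(N) \<rightarrow> j\<^sub>*(P)\<close> is again killed by \<open>j\<^sup>*\<close> (\<open>image_of_cokernel_zero\<close>), and so \<open>j\<^sub>*(N) \<in> S\<close>.

  Finally all six functors map the full subcategories into each other, adjunctions and full
  faithfulness pass to full subcategories, and a wide subcategory is abelian in its own right
  (\<open>abelian_full_subcat\<close>).

  Arguments that have a mirror image are carried out once and transferred by means of the opposite
  category. Short exact sequences are treated through the self-dual description
  \<open>short_exact_iff\<close>.
\<close>

section \<open>Elementary facts on categories and preadditive categories\<close>

definition iso_arr :: "('o, 'a, 'm) cat_scheme \<Rightarrow> 'a \<Rightarrow> bool" where
  "iso_arr C f \<longleftrightarrow> f \<in> Arr C \<and> (\<exists>g \<in> Hom C (Cod C f) (Dom C f).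
     Comp C g f = Id C (Dom C f) \<and> Comp C f g = Id C (Cod C f))"

lemma in_HomD:
  assumes "f \<in> Hom C x y"
  shows "f \<in> Arr C" "Dom C f = x" "Cod C f = y"
  using assms by (auto simp: Hom_def)

context category
begin

lemma Hom_obj:
  assumes "f \<in> Hom C x y"
  shows "x \<in> Obj C" "y \<in> Obj C"
  using assms dom_obj cod_obj by (auto simp: Hom_def)

lemma monic_iff:
  assumes "f \<in> Hom C x y"
  shows "monic C f \<longleftrightarrow>
    (\<forall>w. \<forall>u \<in> Hom C w x. \<forall>v \<in> Hom C w x. Comp C f u = Comp C f v \<longrightarrow> u = v)"
  using in_HomD[OF assms] by (simp add: monic_def)

lemma isomorphic_refl: "x \<in> Obj C \<Longrightarrow> isomorphic C x x"
  unfolding isomorphic_def using id_hom comp_id by blast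

lemma isomorphic_sym: "isomorphic C x y \<Longrightarrow> isomorphic C y x"
  unfolding isomorphic_def by blast

lemma iso_arr_imp_isomorphic: "f \<in> Hom C x y \<Longrightarrow> iso_arr C f \<Longrightarrow> isomorphic C x y"
  unfolding iso_arr_def isomorphic_def using in_HomD[of f C x y] by metis

text \<open>The part of the Yoneda lemma that is needed below: testing against the two objects
  \<open>x\<close> and \<open>y\<close> produces the inverse.\<close>

lemma iso_arr_if_precomp_bij:
  assumes f: "f \<in> Hom C x y"
    and bij: "\<And>z. z \<in> Obj C \<Longrightarrow> bij_betw (\<lambda>h. Comp C h f) (Hom C y z) (Hom C x z)"
  shows "iso_arr C f"
proof -
  have x: "x \<in> Obj C" and y: "y \<in> Obj C" using Hom_obj[OF f] by auto
  obtain g where g: "g \<in> Hom C y x" and gf: "Comp C g f = Id C x"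
    using bij[OF x] id_hom[OF x] unfolding bij_betw_def by (metis imageE)
  have "Comp C (Comp C f g) f = Comp C (Id C y) f"
    using comp_assoc[OF f g f] gf comp_id[OF f] id_comp[OF f] by simp
  then have "Comp C f g = Id C y"
    using bij[OF y] comp_hom[OF g f] id_hom[OF y] unfolding bij_betw_def inj_on_def by blast
  then show ?thesis unfolding iso_arr_def using in_HomD[OF f] g gf by auto
qed

lemma inverse_iso_arr:
  assumes "iso_arr C f" "f \<in> Hom C x y" "g \<in> Hom C y x" "Comp C f g = Id C y"
  shows "iso_arr C g"
proof -
  obtain h where h: "h \<in> Hom C y x" "Comp C h f = Id C x"
    using assms(1,2) unfolding iso_arr_def by (auto simp: Hom_def)
  have "h = Comp C h (Comp C f g)" using assms(4) comp_id[OF h(1)] by simp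
  also have "\<dots> = g" using comp_assoc[OF assms(3,2) h(1)] h(2) id_comp[OF assms(3)] by simp
  finally have "h = g" .
  then show ?thesis unfolding iso_arr_def using assms in_HomD[OF assms(3)] h by auto
qed

end

context preadditive
begin

lemma zero_hom: "x \<in> Obj C \<Longrightarrow> y \<in> Obj C \<Longrightarrow> Zero C x y \<in> Hom C x y"
  using comm_group.axioms(2)[OF hom_group] group.is_monoid monoid.one_closed by fastforce

lemma comp_zero:
  assumes "x \<in> Obj C" "h \<in> Hom C y z"
  shows "Comp C h (Zero C x y) = Zero C x z"
proof -
  have y: "y \<in> Obj C" and z: "z \<in> Obj C" using Hom_obj[OF assms(2)] by auto
  interpret G: comm_group "\<lparr>carrier = Hom C x y, mult = Add C, one = Zero C x y\<rparr>"
    by (rule hom_group[OF assms(1) y])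
  interpret H: comm_group "\<lparr>carrier = Hom C x z, mult = Add C, one = Zero C x z\<rparr>"
    by (rule hom_group[OF assms(1) z])
  have "Add C (Comp C h (Zero C x y)) (Comp C h (Zero C x y)) = Comp C h (Zero C x y)"
    using comp_add[OF G.one_closed[simplified] G.one_closed[simplified] assms(2)] G.l_one G.one_closed
    by simp
  then show ?thesis
    using H.r_cancel_one comp_hom[OF G.one_closed[simplified] assms(2)] by simp
qed

lemma zero_comp:
  assumes "z \<in> Obj C" "h \<in> Hom C x y"
  shows "Comp C (Zero C y z) h = Zero C x z"
proof -
  have x: "x \<in> Obj C" and y: "y \<in> Obj C" using Hom_obj[OF assms(2)] by auto
  interpret G: comm_group "\<lparr>carrier = Hom C y z, mult = Add C, one = Zero C y z\<rparr>"
    by (rule hom_group[OF y assms(1)])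
  interpret H: comm_group "\<lparr>carrier = Hom C x z, mult = Add C, one = Zero C x z\<rparr>"
    by (rule hom_group[OF x assms(1)])
  have "Add C (Comp C (Zero C y z) h) (Comp C (Zero C y z) h) = Comp C (Zero C y z) h"
    using add_comp[OF assms(2) G.one_closed[simplified] G.one_closed[simplified]] G.l_one G.one_closed
    by simp
  then show ?thesis
    using H.r_cancel_one comp_hom[OF assms(2) G.one_closed[simplified]] by simp
qed

text \<open>The arrow \<open>w\<close> is \<open>u - v\<close>; it turns equalities into vanishing statements.\<close>

lemma ex_difference:
  assumes u: "u \<in> Hom C x y" and v: "v \<in> Hom C x y"
  obtains w where "w \<in> Hom C x y"
    and "w = Zero C x y \<longleftrightarrow> u = v"
    and "\<And>z h. h \<in> Hom C y z \<Longrightarrow> Comp C h w = Zero C x z \<longleftrightarrow> Comp C h u = Comp C h v"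
proof -
  have obj: "x \<in> Obj C" "y \<in> Obj C" using Hom_obj[OF u] by auto
  let ?G = "\<lparr>carrier = Hom C x y, mult = Add C, one = Zero C x y\<rparr>"
  interpret G: comm_group ?G by (rule hom_group[OF obj])
  obtain n where n: "n \<in> Hom C x y" and vn: "Add C v n = Zero C x y"
    using G.r_inv[of v] G.inv_closed[of v] v by fastforce
  have w: "Add C u n \<in> Hom C x y" using G.m_closed u n by simp
  have "Comp C h (Add C u n) = Zero C x z \<longleftrightarrow> Comp C h u = Comp C h v" if h: "h \<in> Hom C y z" for h z
  proof -
    interpret H: comm_group "\<lparr>carrier = Hom C x z, mult = Add C, one = Zero C x z\<rparr>"
      by (rule hom_group[OF obj(1) Hom_obj(2)[OF h]])
    have "Add C (Comp C h v) (Comp C h n) = Zero C x z"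
      using comp_add[OF v n h] vn comp_zero[OF obj(1) h] by simp
    then show ?thesis
      using comp_add[OF u n h] H.right_cancel[of "Comp C h n" "Comp C h u" "Comp C h v"]
        comp_hom[OF u h] comp_hom[OF v h] comp_hom[OF n h] by auto
  qed
  moreover have "Add C u n = Zero C x y \<longleftrightarrow> u = v"
    using vn G.right_cancel[of n u v] u v n by auto
  ultimately show thesis using that w by blast
qed

lemma monic_iff_trivial_null:
  assumes f: "f \<in> Hom C x y"
  shows "monic C f \<longleftrightarrow> (\<forall>w. \<forall>u \<in> Hom C w x. Comp C f u = Zero C w y \<longrightarrow> u = Zero C w x)"
proof
  assume "monic C f"
  then show "\<forall>w. \<forall>u \<in> Hom C w x. Comp C f u = Zero C w y \<longrightarrow> u = Zero C w x"
    using comp_zero f monic_iff zero_hom Hom_obj by metis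
next
  assume null: "\<forall>w. \<forall>u \<in> Hom C w x. Comp C f u = Zero C w y \<longrightarrow> u = Zero C w x"
  show "monic C f"
    unfolding monic_iff[OF f]
  proof (intro allI ballI impI)
    fix w u v assume u: "u \<in> Hom C w x" and v: "v \<in> Hom C w x" and "Comp C f u = Comp C f v"
    then show "u = v" using ex_difference[OF u v] null f by metis
  qed
qed

lemma zero_object_iff: "zero_object C z \<longleftrightarrow> z \<in> Obj C \<and> Id C z = Zero C z z"
proof
  assume "zero_object C z"
  then show "z \<in> Obj C \<and> Id C z = Zero C z z"
    unfolding zero_object_def using zero_hom id_hom by blast
next
  assume z: "z \<in> Obj C \<and> Id C z = Zero C z z"
  have "f = Zero C z x" if "f \<in> Hom C z x" for f x
    using comp_id[OF that] comp_zero[OF _ that] z by metis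
  moreover have "f = Zero C x z" if "f \<in> Hom C x z" for f x
    using id_comp[OF that] zero_comp[OF _ that] z by metis
  ultimately show "zero_object C z" unfolding zero_object_def using z zero_hom by blast
qed

lemma zero_object_hom_unique:
  assumes "zero_object C z"
  shows "f \<in> Hom C x z \<Longrightarrow> f = Zero C x z" "f \<in> Hom C z x \<Longrightarrow> f = Zero C z x"
proof -
  have "z \<in> Obj C" using assms unfolding zero_object_def by simp
  then show "f \<in> Hom C x z \<Longrightarrow> f = Zero C x z" "f \<in> Hom C z x \<Longrightarrow> f = Zero C z x"
    using assms Hom_obj[of f] zero_hom unfolding zero_object_def by metis+
qed

section \<open>Kernels and cokernels\<close>

lemma is_kernel_iff:
  assumes f: "f \<in> Hom C y z" and k: "k \<in> Hom C x y"
  shows "is_kernel C f k \<longleftrightarrow> Comp C f k = Zero C x z \<and> monic C k \<and>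
    (\<forall>w. \<forall>h \<in> Hom C w y. Comp C f h = Zero C w z \<longrightarrow> (\<exists>u \<in> Hom C w x. Comp C k u = h))"
    (is "?L \<longleftrightarrow> ?R")
proof
  assume L: ?L
  then have fk: "Comp C f k = Zero C x z"
    and uni: "\<And>w h. h \<in> Hom C w y \<Longrightarrow> Comp C f h = Zero C w z \<Longrightarrow>
      \<exists>!u. u \<in> Hom C w x \<and> Comp C k u = h"
    using in_HomD[OF f] in_HomD[OF k] unfolding is_kernel_def by auto
  have "u = v" if u: "u \<in> Hom C w x" and v: "v \<in> Hom C w x" and eq: "Comp C k u = Comp C k v"
    for w u v
  proof -
    have "Comp C f (Comp C k u) = Zero C w z"
      using comp_assoc[OF u k f] fk zero_comp[OF _ u] Hom_obj[OF f] by simp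
    then show ?thesis using uni[OF comp_hom[OF u k]] u v eq by metis
  qed
  then show ?R using fk uni unfolding monic_iff[OF k] by blast
next
  assume ?R
  then show ?L using in_HomD[OF f] in_HomD[OF k] unfolding is_kernel_def monic_iff[OF k]
    by (auto, blast+)
qed

lemma is_kernel_Hom:
  assumes "is_kernel C f k"
  shows "f \<in> Hom C (Cod C k) (Cod C f)" "k \<in> Hom C (Dom C k) (Cod C k)" "Cod C k = Dom C f"
  using assms unfolding is_kernel_def Hom_def by auto

lemma is_kernel_comp: "is_kernel C f k \<Longrightarrow> Comp C f k = Zero C (Dom C k) (Cod C f)"
  unfolding is_kernel_def by blast

lemma is_kernel_monic: "is_kernel C f k \<Longrightarrow> monic C k"
  using is_kernel_iff[OF is_kernel_Hom(1,2)] by blast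

lemma is_kernel_lift:
  assumes "is_kernel C f k" "h \<in> Hom C w (Dom C f)" "Comp C f h = Zero C w (Cod C f)"
  obtains u where "u \<in> Hom C w (Dom C k)" "Comp C k u = h"
  using assms unfolding is_kernel_def by blast

text \<open>A kernel of \<open>f\<close> depends only on which arrows \<open>f\<close> annihilates.\<close>

lemma is_kernel_transfer:
  assumes k: "is_kernel C f k" and g: "g \<in> Hom C (Dom C f) z"
    and null: "\<And>w h. h \<in> Hom C w (Dom C f) \<Longrightarrow>
      Comp C g h = Zero C w z \<longleftrightarrow> Comp C f h = Zero C w (Cod C f)"
  shows "is_kernel C g k"
proof -
  note H = is_kernel_Hom[OF k]
  have g': "g \<in> Hom C (Cod C k) z" using g H(3) by simp
  show ?thesis
    using k null H unfolding is_kernel_iff[OF g' H(2)] is_kernel_iff[OF H(1,2)] by simp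
qed

lemma is_kernel_same_null:
  assumes k: "is_kernel C f k" "is_kernel C g k" and h: "h \<in> Hom C w (Dom C f)"
    and "Comp C f h = Zero C w (Cod C f)"
  shows "Comp C g h = Zero C w (Cod C g)"
proof -
  obtain u where u: "u \<in> Hom C w (Dom C k)" "Comp C k u = h"
    using is_kernel_lift[OF k(1) h assms(4)] .
  show ?thesis
    using comp_assoc[OF u(1) is_kernel_Hom(2,1)[OF k(2)]] u is_kernel_comp[OF k(2)]
      zero_comp[OF _ u(1)] Hom_obj[OF is_kernel_Hom(1)[OF k(2)]] by simp
qed

lemma is_kernel_exchange:
  assumes "is_kernel C f k" "is_kernel C f m" "is_kernel C g m"
  shows "is_kernel C g k"
proof (rule is_kernel_transfer[OF assms(1)])
  have D: "Dom C g = Dom C f" using is_kernel_Hom(3) assms(2,3) by metis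
  then show "g \<in> Hom C (Dom C f) (Cod C g)" using assms(3) unfolding is_kernel_def Hom_def by auto
  fix w h assume "h \<in> Hom C w (Dom C f)"
  then show "Comp C g h = Zero C w (Cod C g) \<longleftrightarrow> Comp C f h = Zero C w (Cod C f)"
    using is_kernel_same_null assms(2,3) D by metis
qed

text \<open>If \<open>k\<close> is a kernel of \<open>f\<close>, then \<open>f\<close> factors through the cokernel \<open>c\<close> of \<open>k\<close>, and \<open>c\<close> and \<open>f\<close>
  annihilate the same arrows.\<close>

lemma kernel_is_kernel_of_cokernel:
  assumes k: "is_kernel C f k" and c: "is_cokernel C k c"
  shows "is_kernel C c k"
proof (rule is_kernel_transfer[OF k])
  have cH: "c \<in> Hom C (Dom C f) (Cod C c)" and ck: "Comp C c k = Zero C (Dom C k) (Cod C c)"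
    using c is_kernel_Hom(3)[OF k] unfolding is_cokernel_def Hom_def by auto
  note H = is_kernel_Hom[OF k]
  obtain u where u: "u \<in> Hom C (Cod C c) (Cod C f)" "Comp C u c = f"
    using c H(1) is_kernel_comp[OF k] unfolding is_cokernel_def by metis
  show "c \<in> Hom C (Dom C f) (Cod C c)" by (rule cH)
  fix w h assume h: "h \<in> Hom C w (Dom C f)"
  show "Comp C c h = Zero C w (Cod C c) \<longleftrightarrow> Comp C f h = Zero C w (Cod C f)"
  proof
    assume "Comp C c h = Zero C w (Cod C c)"
    then show "Comp C f h = Zero C w (Cod C f)"
      using comp_assoc[OF h cH u(1)] u comp_zero[OF _ u(1)] Hom_obj[OF h] by metis
  next
    assume "Comp C f h = Zero C w (Cod C f)"
    then obtain v where v: "v \<in> Hom C w (Dom C k)" "Comp C k v = h" using is_kernel_lift k h by blast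
    then show "Comp C c h = Zero C w (Cod C c)"
      using comp_assoc[OF v(1), of k "Dom C f" c] H cH ck zero_comp[OF _ v(1)] Hom_obj[OF cH] by simp
  qed
qed

lemma iso_is_kernel_zero:
  assumes f: "f \<in> Hom C y x" and g: "g \<in> Hom C x y"
    and gf: "Comp C g f = Id C y" and fg: "Comp C f g = Id C x"
    and z: "z \<in> Obj C"
  shows "is_kernel C (Zero C x z) f"
proof -
  have x: "x \<in> Obj C" and y: "y \<in> Obj C" using Hom_obj[OF f] by auto
  have "u = v" if u: "u \<in> Hom C w y" and v: "v \<in> Hom C w y" and "Comp C f u = Comp C f v" for w u v
    using comp_assoc[OF u f g] comp_assoc[OF v f g] that(3) gf id_comp[OF u] id_comp[OF v] by metis
  moreover have "\<exists>u \<in> Hom C w y. Comp C f u = h" if h: "h \<in> Hom C w x" for w h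
    using comp_assoc[OF h g f] fg id_comp[OF h] comp_hom[OF h g] by metis
  ultimately show ?thesis
    unfolding is_kernel_iff[OF zero_hom[OF x z] f] monic_iff[OF f] using zero_comp[OF z f] by blast
qed

text \<open>The kernel arrow is monic and zero, and this forces the identity of its source to vanish.\<close>

lemma kernel_of_monic_zero:
  assumes "is_kernel C f k" "monic C f"
  shows "zero_object C (Dom C k)"
proof -
  note H = is_kernel_Hom[OF assms(1)]
  have o: "Dom C k \<in> Obj C" "Cod C k \<in> Obj C" using Hom_obj[OF H(2)] by auto
  have "k = Zero C (Dom C k) (Cod C k)"
    using assms(2) H is_kernel_comp[OF assms(1)] unfolding monic_iff_trivial_null[OF H(1)] by blast
  then have "Comp C k (Id C (Dom C k)) = Zero C (Dom C k) (Cod C k)"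
    using comp_id[OF H(2)] by simp
  then show ?thesis
    using is_kernel_monic[OF assms(1)] id_hom[OF o(1)] o
    unfolding monic_iff_trivial_null[OF H(2)] zero_object_iff by blast
qed

lemma zero_object_arrow_is_kernel:
  assumes "zero_object C z" "f \<in> Hom C x y" "monic C f"
  shows "is_kernel C f (Zero C z x)"
proof -
  have o: "z \<in> Obj C" "x \<in> Obj C" "y \<in> Obj C"
    using assms(1) Hom_obj[OF assms(2)] unfolding zero_object_def by auto
  note H = zero_hom[OF o(1,2)]
  have "u = v" if "u \<in> Hom C w z" "v \<in> Hom C w z" for w u v
    using zero_object_hom_unique(1)[OF assms(1)] that by metis
  moreover have "\<exists>u \<in> Hom C w z. Comp C (Zero C z x) u = h"
    if h: "h \<in> Hom C w x" "Comp C f h = Zero C w y" for w h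
  proof -
    have w: "w \<in> Obj C" using Hom_obj[OF h(1)] by simp
    have "h = Zero C w x" using h assms(3) unfolding monic_iff_trivial_null[OF assms(2)] by blast
    then show ?thesis using zero_comp[OF o(2) zero_hom[OF w o(1)]] zero_hom[OF w o(1)] by blast
  qed
  ultimately show ?thesis
    unfolding is_kernel_iff[OF assms(2) H] monic_iff[OF H] using comp_zero[OF o(1) assms(2)] by blast
qed

lemma iso_arr_monic:
  assumes "iso_arr C f"
  shows "monic C f"
proof -
  obtain g where f: "f \<in> Hom C (Dom C f) (Cod C f)" and g: "g \<in> Hom C (Cod C f) (Dom C f)"
    and gf: "Comp C g f = Id C (Dom C f)" using assms unfolding iso_arr_def Hom_def by blast
  have "u = v" if u: "u \<in> Hom C w (Dom C f)" and v: "v \<in> Hom C w (Dom C f)"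
    and "Comp C f u = Comp C f v" for w u v
    using comp_assoc[OF u f g] comp_assoc[OF v f g] that(3) gf id_comp[OF u] id_comp[OF v] by metis
  then show ?thesis unfolding monic_iff[OF f] by blast
qed

end

section \<open>The opposite category\<close>

definition dual_cat :: "('o, 'a, 'm) ab_cat_scheme \<Rightarrow> ('o, 'a, 'm) ab_cat_scheme" where
  "dual_cat C = C\<lparr>Dom := Cod C, Cod := Dom C, Comp := \<lambda>g f. Comp C f g, Zero := \<lambda>x y. Zero C y x\<rparr>"

lemma dual_cat_simps [simp]:
  "Obj (dual_cat C) = Obj C" "Arr (dual_cat C) = Arr C" "Dom (dual_cat C) = Cod C"
  "Cod (dual_cat C) = Dom C" "Id (dual_cat C) = Id C" "Comp (dual_cat C) g f = Comp C f g"
  "Add (dual_cat C) = Add C" "Zero (dual_cat C) x y = Zero C y x"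
  by (simp_all add: dual_cat_def)

lemma Hom_dual [simp]: "Hom (dual_cat C) x y = Hom C y x"
  by (auto simp: Hom_def)

lemma full_subcat_dual: "full_subcat (dual_cat C) S = dual_cat (full_subcat C S)"
  by (simp add: full_subcat_def dual_cat_def conj_commute)

lemma is_kernel_dual [simp]: "is_kernel (dual_cat C) f k \<longleftrightarrow> is_cokernel C f k"
  by (simp add: is_kernel_def is_cokernel_def)

lemma is_cokernel_dual [simp]: "is_cokernel (dual_cat C) f k \<longleftrightarrow> is_kernel C f k"
  by (simp add: is_kernel_def is_cokernel_def)

lemma monic_dual [simp]: "monic (dual_cat C) f \<longleftrightarrow> epic C f"
  by (simp add: monic_def epic_def)

lemma epic_dual [simp]: "epic (dual_cat C) f \<longleftrightarrow> monic C f"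
  by (simp add: monic_def epic_def)

lemma zero_object_dual [simp]: "zero_object (dual_cat C) = zero_object C"
  by (rule ext) (simp add: zero_object_def conj_commute)

lemma isomorphic_dual [simp]: "isomorphic (dual_cat C) = isomorphic C"
  by (intro ext) (simp add: isomorphic_def, blast)

lemma iso_arr_dual [simp]: "iso_arr (dual_cat C) f \<longleftrightarrow> iso_arr C f"
  by (simp add: iso_arr_def, blast)

lemma category_dual:
  assumes "category C"
  shows "category (dual_cat C)"
proof -
  interpret category C by fact
  show ?thesis
    by unfold_locales
      (simp_all add: dom_obj cod_obj id_hom comp_hom comp_id id_comp comp_assoc)
qed

lemma preadditive_dual:
  assumes "preadditive C"
  shows "preadditive (dual_cat C)"
proof -
  interpret preadditive C by fact
  interpret D: category "dual_cat C" by (rule category_dual) unfold_locales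
  show ?thesis
    by (intro preadditive.intro preadditive_axioms.intro D.category_axioms)
      (simp_all add: hom_group comp_add add_comp)
qed

lemma abelian_dual:
  assumes "abelian_category C"
  shows "abelian_category (dual_cat C)"
proof -
  interpret abelian_category C by fact
  interpret D: preadditive "dual_cat C" by (rule preadditive_dual) unfold_locales
  show ?thesis
  proof
    fix x y assume "x \<in> Obj (dual_cat C)" "y \<in> Obj (dual_cat C)"
    then obtain s i1 i2 p1 p2 where "is_biproduct C x y s i1 i2 p1 p2"
      using ex_biproduct[of x y] by (simp, blast)
    then have "is_biproduct (dual_cat C) x y s p1 p2 i1 i2" by (simp add: is_biproduct_def)
    then show "\<exists>s i1 i2 p1 p2. is_biproduct (dual_cat C) x y s i1 i2 p1 p2" by blast
  qed (simp_all add: ex_zero ex_kernel ex_cokernel monic_is_kernel epic_is_cokernel)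
qed

section \<open>Exactness in abelian categories\<close>

lemma (in abelian_category) monic_is_kernel_of_cokernel:
  assumes "monic C f" "is_cokernel C f c"
  shows "is_kernel C c f"
  using monic_is_kernel[OF assms(1)] kernel_is_kernel_of_cokernel assms(2) by blast

lemma (in abelian_category) epic_is_cokernel_of_kernel:
  assumes "epic C f" "is_kernel C f k"
  shows "is_cokernel C k f"
  using abelian_category.monic_is_kernel_of_cokernel[OF abelian_dual[OF abelian_category_axioms], of f k] assms
  by simp

context abelian_category
begin

lemma epic_iff_trivial_null:
  assumes "f \<in> Hom C x y"
  shows "epic C f \<longleftrightarrow> (\<forall>z. \<forall>u \<in> Hom C y z. Comp C u f = Zero C x z \<longrightarrow> u = Zero C y z)"
  using preadditive.monic_iff_trivial_null[OF preadditive_dual[OF preadditive_axioms], of f y x] assms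
  by simp

lemma monic_comp:
  assumes "f \<in> Hom C x y" "g \<in> Hom C y z" "monic C f" "monic C g"
  shows "monic C (Comp C g f)"
proof -
  have "u = v" if u: "u \<in> Hom C w x" and v: "v \<in> Hom C w x"
    and eq: "Comp C (Comp C g f) u = Comp C (Comp C g f) v" for u v w
  proof -
    have "Comp C g (Comp C f u) = Comp C g (Comp C f v)"
      using eq comp_assoc[OF u assms(1,2)] comp_assoc[OF v assms(1,2)] by simp
    then have "Comp C f u = Comp C f v"
      using assms(4) comp_hom[OF u assms(1)] comp_hom[OF v assms(1)]
      unfolding monic_iff[OF assms(2)] by blast
    then show "u = v" using assms(3) u v unfolding monic_iff[OF assms(1)] by blast
  qed
  then show ?thesis unfolding monic_iff[OF comp_hom[OF assms(1,2)]] by blast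
qed

text \<open>The first isomorphism theorem: \<open>h\<close> factors through its image \<open>m\<close> by a cokernel of its own
  kernel. The factor \<open>e\<close> is epic because \<open>m\<close> is the smallest subobject through which \<open>h\<close>
  factors: if \<open>w \<circ> e = 0\<close>, then \<open>h\<close> also factors through the subobject \<open>m \<circ> ker w\<close>, which is
  itself a kernel and must therefore contain \<open>m\<close>.\<close>

lemma image_factorization:
  assumes h: "h \<in> Hom C x y" and k: "is_kernel C h k" and c: "is_cokernel C h c"
    and m: "is_kernel C c m"
  obtains e where "e \<in> Hom C x (Dom C m)" "is_kernel C e k" "is_cokernel C k e"
proof -
  have cH: "c \<in> Hom C y (Cod C c)" and ch: "Comp C c h = Zero C x (Cod C c)"
    using c in_HomD[OF h] unfolding is_cokernel_def Hom_def by auto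
  have mH: "m \<in> Hom C (Dom C m) y" using is_kernel_Hom[OF m] in_HomD[OF cH] by simp
  have mmon: "monic C m" by (rule is_kernel_monic[OF m])
  obtain e where e: "e \<in> Hom C x (Dom C m)" and me: "Comp C m e = h"
    using is_kernel_lift[OF m] h ch in_HomD[OF cH] by metis
  have epi: "epic C e"
    unfolding epic_iff_trivial_null[OF e]
  proof (intro allI ballI impI)
    fix z w assume w: "w \<in> Hom C (Dom C m) z" and we: "Comp C w e = Zero C x z"
    obtain l where l: "is_kernel C w l" using ex_kernel in_HomD(1)[OF w] by blast
    have lH: "l \<in> Hom C (Dom C l) (Dom C m)" using is_kernel_Hom[OF l] in_HomD[OF w] by simp
    obtain e' where e': "e' \<in> Hom C x (Dom C l)" "Comp C l e' = e"
      using is_kernel_lift[OF l] e we in_HomD[OF w] by metis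
    let ?n = "Comp C m l"
    have nH: "?n \<in> Hom C (Dom C l) y" by (rule comp_hom[OF lH mH])
    have "monic C ?n" by (rule monic_comp[OF lH mH is_kernel_monic[OF l] mmon])
    then obtain r where r: "is_kernel C r ?n" using monic_is_kernel by blast
    have rH: "r \<in> Hom C y (Cod C r)" using is_kernel_Hom[OF r] in_HomD[OF nH] by simp
    have ne: "Comp C ?n e' = h" using comp_assoc[OF e'(1) lH mH] e'(2) me by simp
    have "Comp C r h = Comp C (Comp C r ?n) e'" using comp_assoc[OF e'(1) nH rH] ne by simp
    also have "\<dots> = Zero C x (Cod C r)"
      using is_kernel_comp[OF r] in_HomD[OF nH] zero_comp[OF _ e'(1)] Hom_obj[OF rH] by simp
    finally have "\<exists>r'. r' \<in> Hom C (Cod C c) (Cod C r) \<and> Comp C r' c = r"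
      using c rH in_HomD[OF h] unfolding is_cokernel_def by metis
    then obtain r' where r': "r' \<in> Hom C (Cod C c) (Cod C r)" "Comp C r' c = r" by blast
    have "Comp C r m = Zero C (Dom C m) (Cod C r)"
      using comp_assoc[OF mH cH r'(1)] r'(2) is_kernel_comp[OF m]
        comp_zero[OF _ r'(1)] Hom_obj[OF mH] by simp
    then obtain s where s: "s \<in> Hom C (Dom C m) (Dom C l)" "Comp C ?n s = m"
      using is_kernel_lift[OF r] mH in_HomD[OF nH] in_HomD[OF rH] by metis
    have "Comp C m (Comp C l s) = Comp C m (Id C (Dom C m))"
      using comp_assoc[OF s(1) lH mH] s(2) comp_id[OF mH] by simp
    then have "Comp C l s = Id C (Dom C m)"
      using mmon comp_hom[OF s(1) lH] id_hom Hom_obj[OF mH] unfolding monic_iff[OF mH] by blast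
    then have "w = Comp C (Comp C w l) s" using comp_assoc[OF s(1) lH w] comp_id[OF w] by simp
    then show "w = Zero C (Dom C m) z"
      using is_kernel_comp[OF l] in_HomD[OF w] zero_comp[OF _ s(1)] Hom_obj[OF w] by simp
  qed
  have "is_kernel C e k"
  proof (rule is_kernel_transfer[OF k])
    show "e \<in> Hom C (Dom C h) (Dom C m)" using e in_HomD[OF h] by simp
    fix w u assume "u \<in> Hom C w (Dom C h)"
    then have u: "u \<in> Hom C w x" using in_HomD[OF h] by simp
    have eq: "Comp C h u = Comp C m (Comp C e u)" using comp_assoc[OF u e mH] me by simp
    have "Comp C e u = Zero C w (Dom C m)" if "Comp C h u = Zero C w y"
      using that eq mmon comp_hom[OF u e] unfolding monic_iff_trivial_null[OF mH] by metis
    then show "Comp C e u = Zero C w (Dom C m) \<longleftrightarrow> Comp C h u = Zero C w (Cod C h)"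
      using eq comp_zero[OF Hom_obj(1)[OF u] mH] in_HomD(3)[OF h] by metis
  qed
  then show thesis using that e epic_is_cokernel_of_kernel[OF epi] by blast
qed

lemma exact_at_kernel_cokernel:
  assumes "is_kernel C g f" "is_cokernel C f g"
  shows "exact_at C f g"
  using assms in_HomD(1)[OF is_kernel_Hom(1)[OF assms(1)]]
    in_HomD(1)[OF is_kernel_Hom(2)[OF assms(1)]] is_kernel_Hom(3)[OF assms(1)]
  unfolding exact_at_def is_image_def by blast

lemma identity_is_kernel_zero:
  assumes "x \<in> Obj C" "y \<in> Obj C"
  shows "is_kernel C (Zero C x y) (Id C x)"
  using iso_is_kernel_zero[OF id_hom id_hom _ _ assms(2)] assms(1) comp_id[OF id_hom] by blast

lemma cokernel_epic: "is_cokernel C f c \<Longrightarrow> epic C c"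
  using preadditive.is_kernel_monic[OF preadditive_dual[OF preadditive_axioms], of f c] by simp

text \<open>Exactness at the two ends forces \<open>f\<close> to be monic and \<open>g\<close> to be epic, and a monic arrow of an
  abelian category is determined by its cokernel. The resulting description is symmetric in kernels
  and cokernels and so shows that the notion is self-dual.\<close>

lemma short_exact_iff: "short_exact C f g \<longleftrightarrow> is_kernel C g f \<and> is_cokernel C f g"
proof
  assume "is_kernel C g f \<and> is_cokernel C f g"
  then have k: "is_kernel C g f" and c: "is_cokernel C f g" by auto
  obtain z where z: "zero_object C z" using ex_zero by blast
  have zo: "z \<in> Obj C" using z unfolding zero_object_def by simp
  note H = is_kernel_Hom[OF k]
  note o = Hom_obj[OF H(2)] Hom_obj[OF H(1)]
  interpret D: abelian_category "dual_cat C" by (rule abelian_dual) unfold_locales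
  have id_mon: "monic C (Id C x)" if "x \<in> Obj C" for x
    using that id_comp unfolding monic_iff[OF id_hom[OF that]] by metis
  have 1: "is_kernel C f (Zero C z (Dom C f))"
    by (rule zero_object_arrow_is_kernel[OF z H(2) is_kernel_monic[OF k]])
  have "is_kernel C (Id C (Dom C f)) (Zero C z (Dom C f))"
    by (rule zero_object_arrow_is_kernel[OF z id_hom[OF o(1)] id_mon[OF o(1)]])
  moreover have "is_cokernel C (Zero C z (Dom C f)) (Id C (Dom C f))"
    using D.identity_is_kernel_zero[of "Dom C f" z] zo o by simp
  ultimately have ex1: "exact_at C (Zero C z (Dom C f)) f"
    using 1 in_HomD[OF zero_hom[OF zo o(1)]] in_HomD[OF H(2)] unfolding exact_at_def is_image_def
    by auto
  have "is_cokernel C g (Zero C (Cod C g) z)"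
    using D.zero_object_arrow_is_kernel[of z g "Cod C g" "Cod C f"] z H cokernel_epic[OF c] by simp
  then have ex3: "exact_at C g (Zero C (Cod C g) z)"
    using identity_is_kernel_zero[OF o(4) zo] in_HomD[OF zero_hom[OF o(4) zo]] in_HomD[OF H(1)]
    unfolding exact_at_def is_image_def by auto
  show "short_exact C f g"
    using z ex1 ex3 exact_at_kernel_cokernel[OF k c] unfolding short_exact_def by blast
next
  assume "short_exact C f g"
  then obtain z where z: "zero_object C z" and ex1: "exact_at C (Zero C z (Dom C f)) f"
    and ex2: "exact_at C f g" and ex3: "exact_at C g (Zero C (Cod C g) z)"
    unfolding short_exact_def by blast
  have zo: "z \<in> Obj C" using z unfolding zero_object_def by simp
  have fH: "f \<in> Hom C (Dom C f) (Cod C f)" and gH: "g \<in> Hom C (Cod C f) (Cod C g)"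
    using ex2 unfolding exact_at_def Hom_def by auto
  note o = Hom_obj[OF fH] Hom_obj[OF gH]
  have fmon: "monic C f"
  proof -
    obtain m c where c: "is_cokernel C (Zero C z (Dom C f)) c" and m: "is_kernel C c m"
      and mf: "is_kernel C f m" using ex1 unfolding exact_at_def is_image_def by blast
    \<comment> \<open>a cokernel of an arrow out of a zero object is split monic, so its kernel vanishes\<close>
    have cH: "c \<in> Hom C (Dom C f) (Cod C c)"
      using c in_HomD[OF zero_hom[OF zo o(1)]] unfolding is_cokernel_def Hom_def by auto
    obtain u where u: "u \<in> Hom C (Cod C c) (Dom C f)" "Comp C u c = Id C (Dom C f)"
      using c id_hom[OF o(1)] in_HomD[OF zero_hom[OF zo o(1)]] id_comp[OF zero_hom[OF zo o(1)]]
      unfolding is_cokernel_def by metis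
    have "h = Zero C w (Dom C f)"
      if h: "h \<in> Hom C w (Dom C f)" and fh: "Comp C f h = Zero C w (Cod C f)" for w h
    proof -
      have w: "w \<in> Obj C" using Hom_obj[OF h] by simp
      have "Comp C c h = Zero C w (Cod C c)" by (rule is_kernel_same_null[OF mf m h fh])
      then have "Comp C (Comp C u c) h = Zero C w (Dom C f)"
        using comp_assoc[OF h cH u(1)] comp_zero[OF w u(1)] by simp
      then show ?thesis using u(2) id_comp[OF h] by simp
    qed
    then show ?thesis unfolding monic_iff_trivial_null[OF fH] by blast
  qed
  obtain m c where c: "is_cokernel C f c" and mc: "is_kernel C c m" and mg: "is_kernel C g m"
    using ex2 unfolding exact_at_def is_image_def by blast
  have k: "is_kernel C g f"
    by (rule is_kernel_exchange[OF monic_is_kernel_of_cokernel[OF fmon c] mc mg])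
  have "epic C g"
  proof -
    obtain m c where c: "is_cokernel C g c" and m: "is_kernel C c m"
      and m0: "is_kernel C (Zero C (Cod C g) z) m"
      using ex3 unfolding exact_at_def is_image_def by blast
    have cH: "c \<in> Hom C (Cod C g) (Cod C c)" using c unfolding is_cokernel_def Hom_def by auto
    have "Comp C c (Id C (Cod C g)) = Zero C (Cod C g) (Cod C c)"
      by (rule is_kernel_same_null[OF m0 m])
        (use id_hom[OF o(4)] in_HomD[OF zero_hom[OF o(4) zo]] comp_id[OF zero_hom[OF o(4) zo]]
          in auto)
    then have c0: "c = Zero C (Cod C g) (Cod C c)" using comp_id[OF cH] by simp
    have "h = Zero C (Cod C g) w"
      if h: "h \<in> Hom C (Cod C g) w" and hg: "Comp C h g = Zero C (Cod C f) w" for w h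
    proof -
      have "\<exists>u. u \<in> Hom C (Cod C c) w \<and> Comp C u c = h"
        using c h hg in_HomD[OF gH] unfolding is_cokernel_def by metis
      then obtain u where u: "u \<in> Hom C (Cod C c) w" "Comp C u c = h" by blast
      then show ?thesis using c0 comp_zero[OF o(4) u(1)] by metis
    qed
    then show ?thesis unfolding epic_iff_trivial_null[OF gH] by blast
  qed
  then show "is_kernel C g f \<and> is_cokernel C f g" using k epic_is_cokernel_of_kernel by blast
qed

end

section \<open>Wide subcategories are abelian\<close>

context preadditive
begin

lemma add_zero:
  assumes "f \<in> Hom C x y"
  shows "Add C f (Zero C x y) = f" "Add C (Zero C x y) f = f"
proof -
  interpret comm_group "\<lparr>carrier = Hom C x y, mult = Add C, one = Zero C x y\<rparr>"
    by (rule hom_group[OF Hom_obj[OF assms]])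
  show "Add C f (Zero C x y) = f" "Add C (Zero C x y) f = f" using r_one l_one assms by simp_all
qed

lemma add_commute:
  assumes "f \<in> Hom C x y" "g \<in> Hom C x y"
  shows "Add C f g = Add C g f"
proof -
  interpret comm_group "\<lparr>carrier = Hom C x y, mult = Add C, one = Zero C x y\<rparr>"
    by (rule hom_group[OF Hom_obj[OF assms(1)]])
  show ?thesis using m_comm[of f g] assms by simp
qed

lemma add_eq_self:
  assumes "f \<in> Hom C x y" "g \<in> Hom C x y" "Add C f g = g"
  shows "f = Zero C x y"
proof -
  interpret comm_group "\<lparr>carrier = Hom C x y, mult = Add C, one = Zero C x y\<rparr>"
    by (rule hom_group[OF Hom_obj[OF assms(1)]])
  show ?thesis using l_cancel_one[of g f] r_cancel_one[of g f] assms by simp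
qed

lemma is_biproduct_swap:
  assumes "is_biproduct C x y s i1 i2 p1 p2"
  shows "is_biproduct C y x s i2 i1 p2 p1"
proof -
  have "Comp C i1 p1 \<in> Hom C s s" "Comp C i2 p2 \<in> Hom C s s"
    using assms comp_hom unfolding is_biproduct_def by blast+
  then show ?thesis using assms add_commute unfolding is_biproduct_def by metis
qed

text \<open>The composite \<open>p2 \<circ> i1\<close> vanishes because \<open>p2 = p2 \<circ> (i1 \<circ> p1 + i2 \<circ> p2) = p2 \<circ> i1 \<circ> p1 + p2\<close>.\<close>

lemma biproduct_kernel:
  assumes "is_biproduct C x y s i1 i2 p1 p2"
  shows "is_kernel C p2 i1"
proof -
  have i1: "i1 \<in> Hom C x s" and i2: "i2 \<in> Hom C y s" and p1: "p1 \<in> Hom C s x"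
    and p2: "p2 \<in> Hom C s y" and p1i1: "Comp C p1 i1 = Id C x" and p2i2: "Comp C p2 i2 = Id C y"
    and sum: "Add C (Comp C i1 p1) (Comp C i2 p2) = Id C s"
    using assms unfolding is_biproduct_def by auto
  note o = Hom_obj[OF i1] Hom_obj[OF i2]
  note ip1 = comp_hom[OF p1 i1] and ip2 = comp_hom[OF p2 i2]
  have "Add C (Comp C p2 (Comp C i1 p1)) (Comp C p2 (Comp C i2 p2)) = p2"
    using comp_add[OF ip1 ip2 p2] sum comp_id[OF p2] by simp
  then have "Add C (Comp C p2 (Comp C i1 p1)) p2 = p2"
    using comp_assoc[OF p2 i2 p2] p2i2 id_comp[OF p2] by simp
  then have "Comp C p2 (Comp C i1 p1) = Zero C s y"
    by (rule add_eq_self[OF comp_hom[OF ip1 p2] p2])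
  then have "Comp C (Comp C (Comp C p2 i1) p1) i1 = Zero C x y"
    using comp_assoc[OF p1 i1 p2] zero_comp[OF o(3) i1] by simp
  then have zero: "Comp C p2 i1 = Zero C x y"
    using comp_assoc[OF i1 p1 comp_hom[OF i1 p2]] p1i1 comp_id[OF comp_hom[OF i1 p2]] by simp
  have mon: "monic C i1"
    unfolding monic_iff[OF i1]
  proof (intro allI ballI impI)
    fix w u v assume u: "u \<in> Hom C w x" and v: "v \<in> Hom C w x" and eq: "Comp C i1 u = Comp C i1 v"
    show "u = v"
      using eq comp_assoc[OF u i1 p1] comp_assoc[OF v i1 p1] p1i1 id_comp[OF u] id_comp[OF v]
      by metis
  qed
  have "\<exists>u \<in> Hom C w x. Comp C i1 u = h"
    if h: "h \<in> Hom C w s" and ph: "Comp C p2 h = Zero C w y" for w h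
  proof
    have "h = Add C (Comp C (Comp C i1 p1) h) (Comp C (Comp C i2 p2) h)"
      using add_comp[OF h ip1 ip2] sum id_comp[OF h] by simp
    also have "Comp C (Comp C i2 p2) h = Zero C w s"
      using comp_assoc[OF h p2 i2] ph comp_zero[OF Hom_obj(1)[OF h] i2] by simp
    also have "Comp C (Comp C i1 p1) h = Comp C i1 (Comp C p1 h)"
      using comp_assoc[OF h p1 i1] by simp
    finally show "Comp C i1 (Comp C p1 h) = h"
      using add_zero(1)[OF comp_hom[OF comp_hom[OF h p1] i1]] by simp
    show "Comp C p1 h \<in> Hom C w x" by (rule comp_hom[OF h p1])
  qed
  then show ?thesis unfolding is_kernel_iff[OF p2 i1] using zero mon by blast
qed

lemma biproduct_cokernel:
  assumes "is_biproduct C x y s i1 i2 p1 p2"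
  shows "is_cokernel C i1 p2"
proof -
  have "is_biproduct (dual_cat C) y x s p2 p1 i2 i1"
    using is_biproduct_swap[OF assms] by (simp add: is_biproduct_def)
  then show ?thesis
    using preadditive.biproduct_kernel[OF preadditive_dual[OF preadditive_axioms]] by fastforce
qed

end

lemma full_subcat_simps [simp]:
  "Obj (full_subcat C S) = S" "Arr (full_subcat C S) = {f \<in> Arr C. Dom C f \<in> S \<and> Cod C f \<in> S}"
  "Dom (full_subcat C S) = Dom C" "Cod (full_subcat C S) = Cod C" "Id (full_subcat C S) = Id C"
  "Comp (full_subcat C S) = Comp C"
  by (simp_all add: full_subcat_def)

lemma full_subcat_ab_simps [simp]:
  "Add (full_subcat C S) = Add C" "Zero (full_subcat C S) = Zero C"
  by (simp_all add: full_subcat_def)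

lemma Hom_full_subcat: "Hom (full_subcat C S) x y = {f \<in> Hom C x y. x \<in> S \<and> y \<in> S}"
  by (auto simp: Hom_def)

lemma full_subcat_Obj:
  assumes "category C"
  shows "full_subcat C (Obj C) = C"
proof -
  have "{f \<in> Arr C. Dom C f \<in> Obj C \<and> Cod C f \<in> Obj C} = Arr C"
    using category.dom_obj[OF assms] category.cod_obj[OF assms] by blast
  then show ?thesis unfolding full_subcat_def by simp
qed

lemma isomorphic_full_subcat:
  "isomorphic (full_subcat C S) x y \<longleftrightarrow> isomorphic C x y \<and> x \<in> S \<and> y \<in> S"
  unfolding isomorphic_def Hom_full_subcat by auto

lemma category_full_subcat:
  assumes "category C" "S \<subseteq> Obj C"
  shows "category (full_subcat C S)"
proof -
  interpret category C by fact
  show ?thesis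
    by unfold_locales
      (use assms(2) in \<open>auto simp: Hom_full_subcat id_hom comp_hom comp_id id_comp comp_assoc\<close>)
qed

lemma preadditive_full_subcat:
  assumes "preadditive C" "S \<subseteq> Obj C"
  shows "preadditive (full_subcat C S)"
proof -
  interpret preadditive C by fact
  have "Hom (full_subcat C S) x y = Hom C x y" if "x \<in> S" "y \<in> S" for x y
    using that by (simp add: Hom_full_subcat)
  moreover have "category (full_subcat C S)"
    by (rule category_full_subcat[OF _ assms(2)]) unfold_locales
  ultimately show ?thesis
    using assms(2)
    by (intro preadditive.intro preadditive_axioms.intro)
      (auto simp: Hom_full_subcat intro: hom_group comp_add add_comp)
qed

lemma is_kernel_full_subcat:
  assumes "is_kernel C f k" "Dom C k \<in> S" "Dom C f \<in> S" "Cod C f \<in> S"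
  shows "is_kernel (full_subcat C S) f k"
  using assms unfolding is_kernel_def Hom_full_subcat by simp

lemma (in preadditive) zero_object_full_subcat:
  assumes "S \<subseteq> Obj C"
  shows "zero_object (full_subcat C S) z \<longleftrightarrow> z \<in> S \<and> zero_object C z"
  using preadditive.zero_object_iff[OF preadditive_full_subcat[OF preadditive_axioms assms]]
    zero_object_iff assms by auto

locale wide_subcategory = abelian_category C for C :: "('o, 'a, 'm) ab_cat_scheme" +
  fixes S :: "'o set"
  assumes wide: "wide_subcat C S"

lemma wide_subcategoryI: "wide_subcat C S \<Longrightarrow> wide_subcategory C S"
  unfolding wide_subcategory_def wide_subcategory_axioms_def using wide_subcat_def by blast

text \<open>In this form the three closure conditions are visibly exchanged or preserved by duality.\<close>

lemma (in abelian_category) wide_subcat_iff: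
  "wide_subcat C S \<longleftrightarrow> S \<subseteq> Obj C \<and> S \<noteq> {} \<and>
    (\<forall>f k. is_kernel C f k \<and> Dom C f \<in> S \<and> Cod C f \<in> S \<longrightarrow> Dom C k \<in> S) \<and>
    (\<forall>f c. is_cokernel C f c \<and> Dom C f \<in> S \<and> Cod C f \<in> S \<longrightarrow> Cod C c \<in> S) \<and>
    (\<forall>f g. is_kernel C g f \<and> is_cokernel C f g \<and> Dom C f \<in> S \<and> Cod C g \<in> S \<longrightarrow> Cod C f \<in> S)"
proof -
  have "is_kernel C f k \<Longrightarrow> f \<in> Arr C" "is_cokernel C f k \<Longrightarrow> f \<in> Arr C" for f k
    by (simp_all add: is_kernel_def is_cokernel_def)
  then show ?thesis
    unfolding wide_subcat_def short_exact_iff full_subcat_simps mem_Collect_eq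
    using abelian_category_axioms by blast
qed

lemma wide_subcat_dual:
  assumes "wide_subcat C S"
  shows "wide_subcat (dual_cat C) S"
proof -
  have A: "abelian_category C" using assms unfolding wide_subcat_def by blast
  note w = assms[unfolded abelian_category.wide_subcat_iff[OF A]]
  have "Dom C g \<in> S"
    if "is_kernel C g f" "is_cokernel C f g" "Dom C f \<in> S" "Cod C g \<in> S" for f g
  proof -
    have "Cod C f = Dom C g" using that(1) unfolding is_kernel_def by blast
    moreover have "Cod C f \<in> S" using w that by blast
    ultimately show ?thesis by simp
  qed
  then show ?thesis
    unfolding abelian_category.wide_subcat_iff[OF abelian_dual[OF A]] is_kernel_dual is_cokernel_dual
      dual_cat_simps
  proof (intro conjI allI impI)
    show "S \<subseteq> Obj C" "S \<noteq> {}" using w by auto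
    show "Cod C c \<in> S" if "is_cokernel C f c \<and> Cod C f \<in> S \<and> Dom C f \<in> S" for f c
      using w that by blast
    show "Dom C k \<in> S" if "is_kernel C f k \<and> Cod C f \<in> S \<and> Dom C f \<in> S" for f k
      using w that by blast
  qed blast
qed

context wide_subcategory
begin

lemma subset_Obj: "S \<subseteq> Obj C"
  using wide[unfolded wide_subcat_iff] by blast

lemma kernel_mem: "is_kernel C f k \<Longrightarrow> Dom C f \<in> S \<Longrightarrow> Cod C f \<in> S \<Longrightarrow> Dom C k \<in> S"
  using wide[unfolded wide_subcat_iff] by blast

lemma cokernel_mem: "is_cokernel C f c \<Longrightarrow> Dom C f \<in> S \<Longrightarrow> Cod C f \<in> S \<Longrightarrow> Cod C c \<in> S"
  using wide[unfolded wide_subcat_iff] by blast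

lemma extension_mem:
  "is_kernel C g f \<Longrightarrow> is_cokernel C f g \<Longrightarrow> Dom C f \<in> S \<Longrightarrow> Cod C g \<in> S \<Longrightarrow> Cod C f \<in> S"
  using wide[unfolded wide_subcat_iff] by blast

text \<open>An isomorphism is a kernel of a zero arrow, so closure under kernels includes closure under
  isomorphism.\<close>

lemma isomorphic_mem:
  assumes "isomorphic C x y" "x \<in> S"
  shows "y \<in> S"
proof -
  obtain f g where f: "f \<in> Hom C x y" and g: "g \<in> Hom C y x"
    and gf: "Comp C g f = Id C x" and fg: "Comp C f g = Id C y"
    using assms(1) unfolding isomorphic_def by blast
  have "x \<in> Obj C" using Hom_obj[OF f] by simp
  then show ?thesis
    using kernel_mem[OF iso_is_kernel_zero[OF g f fg gf]] in_HomD[OF g] in_HomD[OF zero_hom] assms(2)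
    by metis
qed

text \<open>The image of \<open>h\<close> is the kernel of \<open>y \<rightarrow> coker h\<close> and hence lies in \<open>S\<close>, and \<open>x\<close> is an extension of
  the image by the kernel of \<open>h\<close>.\<close>

lemma dom_mem_if_cod_mem:
  assumes h: "h \<in> Hom C x y" and k: "is_kernel C h k" and c: "is_cokernel C h c"
    and mem: "Dom C k \<in> S" "Cod C c \<in> S" "y \<in> S"
  shows "x \<in> S"
proof -
  obtain m where m: "is_kernel C c m" using ex_kernel c unfolding is_cokernel_def by blast
  have "Dom C c = y" using c in_HomD[OF h] unfolding is_cokernel_def by simp
  then have mS: "Dom C m \<in> S" using kernel_mem[OF m] mem by simp
  obtain e where e: "e \<in> Hom C x (Dom C m)" "is_kernel C e k" "is_cokernel C k e"
    using image_factorization[OF h k c m] .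
  then show ?thesis using extension_mem[OF e(2,3) mem(1)] mS in_HomD[OF e(1)] is_kernel_Hom(3)[OF e(2)]
    by simp
qed

lemma dual: "wide_subcategory (dual_cat C) S"
  by (rule wide_subcategoryI[OF wide_subcat_dual[OF wide]])

lemma cod_mem_if_dom_mem:
  assumes "h \<in> Hom C x y" "is_kernel C h k" "is_cokernel C h c" "Dom C k \<in> S" "Cod C c \<in> S" "x \<in> S"
  shows "y \<in> S"
  using wide_subcategory.dom_mem_if_cod_mem[OF dual, of h y x c k] assms by simp

text \<open>A zero object arises as the kernel of an identity.\<close>

lemma zero_object_mem: "\<exists>z \<in> S. zero_object C z"
proof -
  obtain x where x: "x \<in> S" using wide[unfolded wide_subcat_iff] by blast
  then have o: "x \<in> Obj C" using subset_Obj by blast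
  note I = id_hom[OF o]
  obtain k where k: "is_kernel C (Id C x) k" using ex_kernel in_HomD(1)[OF I] by blast
  have "monic C (Id C x)" using id_comp unfolding monic_iff[OF I] by metis
  then show ?thesis using kernel_of_monic_zero[OF k] kernel_mem[OF k] in_HomD[OF I] x by auto
qed

text \<open>An arrow that is monic in the subcategory has vanishing kernel, since that kernel belongs to
  the subcategory; hence it is monic in \<open>C\<close> and a kernel of its cokernel.\<close>

lemma full_subcat_monic_is_kernel:
  assumes f: "monic (full_subcat C S) f"
  shows "\<exists>g. is_kernel (full_subcat C S) g f"
proof -
  interpret F: preadditive "full_subcat C S"
    by (rule preadditive_full_subcat[OF preadditive_axioms subset_Obj])
  have S: "Dom C f \<in> S" "Cod C f \<in> S" and fH: "f \<in> Hom C (Dom C f) (Cod C f)"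
    using f unfolding monic_def Hom_def by auto
  obtain k where k: "is_kernel C f k" using ex_kernel in_HomD(1)[OF fH] by blast
  have kS: "Dom C k \<in> S" by (rule kernel_mem[OF k S])
  have "zero_object (full_subcat C S) (Dom C k)"
    using F.kernel_of_monic_zero[OF is_kernel_full_subcat[OF k kS S] f] by simp
  then have z: "zero_object C (Dom C k)" using zero_object_full_subcat[OF subset_Obj] by blast
  have "u = Zero C w (Dom C f)"
    if u: "u \<in> Hom C w (Dom C f)" and fu: "Comp C f u = Zero C w (Cod C f)" for w u
  proof -
    obtain v where v: "v \<in> Hom C w (Dom C k)" "Comp C k v = u" by (rule is_kernel_lift[OF k u fu])
    have "k \<in> Hom C (Dom C k) (Dom C f)" using is_kernel_Hom[OF k] by simp
    then show ?thesis
      using v zero_object_hom_unique(1)[OF z v(1)] comp_zero Hom_obj(1)[OF u] by metis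
  qed
  then have mon: "monic C f" unfolding monic_iff_trivial_null[OF fH] by blast
  obtain c where c: "is_cokernel C f c" using ex_cokernel in_HomD(1)[OF fH] by blast
  have "is_kernel C c f" by (rule monic_is_kernel_of_cokernel[OF mon c])
  then show ?thesis
    using is_kernel_full_subcat[of C c f S] S cokernel_mem[OF c S] is_kernel_Hom(3) by metis
qed

lemma full_subcat_ex_kernel:
  assumes "f \<in> Arr (full_subcat C S)"
  shows "\<exists>k. is_kernel (full_subcat C S) f k"
proof -
  have "f \<in> Arr C" and S: "Dom C f \<in> S" "Cod C f \<in> S" using assms by auto
  then obtain k where "is_kernel C f k" using ex_kernel by blast
  then show ?thesis using is_kernel_full_subcat kernel_mem S by metis
qed

text \<open>The biproduct of \<open>x\<close> and \<open>y\<close> is an extension of \<open>y\<close> by \<open>x\<close>.\<close>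

lemma full_subcat_biproduct:
  assumes "x \<in> S" "y \<in> S"
  shows "\<exists>s i1 i2 p1 p2. is_biproduct (full_subcat C S) x y s i1 i2 p1 p2"
proof -
  obtain s i1 i2 p1 p2 where b: "is_biproduct C x y s i1 i2 p1 p2"
    using ex_biproduct subset_Obj assms by blast
  have i1: "i1 \<in> Hom C x s" and p2: "p2 \<in> Hom C s y" using b unfolding is_biproduct_def by auto
  have "s \<in> S"
    using extension_mem[OF biproduct_kernel[OF b] biproduct_cokernel[OF b]] in_HomD[OF i1]
      in_HomD[OF p2] assms by simp
  then have "is_biproduct (full_subcat C S) x y s i1 i2 p1 p2"
    using b assms unfolding is_biproduct_def Hom_full_subcat by simp
  then show ?thesis by blast
qed

theorem abelian_full_subcat: "abelian_category (full_subcat C S)"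
proof -
  interpret D: wide_subcategory "dual_cat C" S by (rule dual)
  interpret F: preadditive "full_subcat C S"
    by (rule preadditive_full_subcat[OF preadditive_axioms subset_Obj])
  show ?thesis
  proof
    show "\<exists>z. zero_object (full_subcat C S) z"
      using zero_object_mem zero_object_full_subcat[OF subset_Obj] by blast
    show "\<exists>c. is_cokernel (full_subcat C S) f c" if "f \<in> Arr (full_subcat C S)" for f
      using D.full_subcat_ex_kernel[of f] that
      unfolding full_subcat_dual is_kernel_dual dual_cat_simps .
    show "\<exists>g. is_cokernel (full_subcat C S) g f" if "epic (full_subcat C S) f" for f
      using D.full_subcat_monic_is_kernel[of f] that
      unfolding full_subcat_dual is_kernel_dual monic_dual .
  qed (use full_subcat_biproduct full_subcat_ex_kernel full_subcat_monic_is_kernel in simp_all)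
qed

end

section \<open>Adjoint functors between abelian categories\<close>

lemma is_functor_obj: "is_functor C D F \<Longrightarrow> x \<in> Obj C \<Longrightarrow> FObj F x \<in> Obj D"
  unfolding is_functor_def by blast

lemma is_functor_hom: "is_functor C D F \<Longrightarrow> f \<in> Hom C x y \<Longrightarrow> FArr F f \<in> Hom D (FObj F x) (FObj F y)"
  unfolding is_functor_def by blast

lemma is_functor_id: "is_functor C D F \<Longrightarrow> x \<in> Obj C \<Longrightarrow> FArr F (Id C x) = Id D (FObj F x)"
  unfolding is_functor_def by blast

lemma is_functor_comp:
  "is_functor C D F \<Longrightarrow> f \<in> Hom C x y \<Longrightarrow> g \<in> Hom C y z \<Longrightarrow>
    FArr F (Comp C g f) = Comp D (FArr F g) (FArr F f)"
  unfolding is_functor_def by blast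

lemma is_functor_isomorphic:
  assumes "category C" "is_functor C D F" "isomorphic C x y"
  shows "isomorphic D (FObj F x) (FObj F y)"
proof -
  obtain f g where f: "f \<in> Hom C x y" and g: "g \<in> Hom C y x"
    and "Comp C g f = Id C x" "Comp C f g = Id C y"
    using assms(3) unfolding isomorphic_def by blast
  moreover have "x \<in> Obj C" "y \<in> Obj C" using category.Hom_obj[OF assms(1) f] by auto
  ultimately have "Comp D (FArr F g) (FArr F f) = Id D (FObj F x)"
    "Comp D (FArr F f) (FArr F g) = Id D (FObj F y)"
    using is_functor_comp[OF assms(2) f g] is_functor_comp[OF assms(2) g f] is_functor_id[OF assms(2)]
    by metis+
  then show ?thesis
    unfolding isomorphic_def using is_functor_hom[OF assms(2) f] is_functor_hom[OF assms(2) g] by blast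
qed

lemma is_functor_dual:
  assumes "is_functor C D F"
  shows "is_functor (dual_cat C) (dual_cat D) F"
  using assms unfolding is_functor_def by simp

lemma fully_faithful_dual: "fully_faithful C D F \<Longrightarrow> fully_faithful (dual_cat C) (dual_cat D) F"
  unfolding fully_faithful_def by simp

text \<open>An adjoint pair with a chosen family of bijections, which makes the unit a term.\<close>

locale adjunction = C: category C + D: category D
  for C :: "('o, 'a, 'm) cat_scheme" and D :: "('p, 'b, 'n) cat_scheme" +
  fixes F :: "('o, 'a, 'p, 'b) func" and G :: "('p, 'b, 'o, 'a) func"
    and \<phi> :: "'o \<Rightarrow> 'p \<Rightarrow> 'b \<Rightarrow> 'a"
  assumes F: "is_functor C D F" and G: "is_functor D C G"
    and bij: "x \<in> Obj C \<Longrightarrow> y \<in> Obj D \<Longrightarrow>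
      bij_betw (\<phi> x y) (Hom D (FObj F x) y) (Hom C x (FObj G y))"
    and natural: "f \<in> Hom C x' x \<Longrightarrow> g \<in> Hom D y y' \<Longrightarrow> h \<in> Hom D (FObj F x) y \<Longrightarrow>
      \<phi> x' y' (Comp D g (Comp D h (FArr F f))) = Comp C (FArr G g) (Comp C (\<phi> x y h) f)"

lemma adjoint_pair_obtain:
  assumes "adjoint_pair C D F G" "category C" "category D"
  obtains \<phi> where "adjunction C D F G \<phi>"
  using assms unfolding adjoint_pair_def adjunction_def adjunction_axioms_def by blast

context adjunction
begin

lemma hom: "x \<in> Obj C \<Longrightarrow> h \<in> Hom D (FObj F x) y \<Longrightarrow> \<phi> x y h \<in> Hom C x (FObj G y)"
  using bij D.Hom_obj bij_betwE by metis

lemma inject: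
  assumes "x \<in> Obj C" "g \<in> Hom D (FObj F x) y" "h \<in> Hom D (FObj F x) y" "\<phi> x y g = \<phi> x y h"
  shows "g = h"
  using bij[OF assms(1) D.Hom_obj(2)[OF assms(2)]] assms unfolding bij_betw_def inj_on_def by blast

lemma surject:
  assumes "y \<in> Obj D" "f \<in> Hom C x (FObj G y)"
  obtains h where "h \<in> Hom D (FObj F x) y" "\<phi> x y h = f"
proof -
  have "f \<in> \<phi> x y ` Hom D (FObj F x) y"
    using bij_betw_imp_surj_on[OF bij[OF C.Hom_obj(1)[OF assms(2)] assms(1)]] assms(2) by simp
  then obtain h where "h \<in> Hom D (FObj F x) y" "f = \<phi> x y h" by (rule imageE)
  then show thesis using that by simp
qed

lemma natural_right:
  assumes "x \<in> Obj C" "g \<in> Hom D y y'" "h \<in> Hom D (FObj F x) y"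
  shows "\<phi> x y' (Comp D g h) = Comp C (FArr G g) (\<phi> x y h)"
  using natural[OF C.id_hom[OF assms(1)] assms(2,3)] is_functor_id[OF F assms(1)]
    D.comp_id[OF assms(3)] C.comp_id[OF hom[OF assms(1,3)]] by simp

lemma natural_left:
  assumes "f \<in> Hom C x' x" "h \<in> Hom D (FObj F x) y"
  shows "\<phi> x' y (Comp D h (FArr F f)) = Comp C (\<phi> x y h) f"
proof -
  have x: "x \<in> Obj C" and y: "y \<in> Obj D"
    using C.Hom_obj[OF assms(1)] D.Hom_obj[OF assms(2)] by auto
  show ?thesis
    using natural[OF assms(1) D.id_hom[OF y] assms(2)] is_functor_id[OF G y]
      D.id_comp[OF D.comp_hom[OF is_functor_hom[OF F assms(1)] assms(2)]]
      C.id_comp[OF C.comp_hom[OF assms(1) hom[OF x assms(2)]]] by simp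
qed

definition unit :: "'o \<Rightarrow> 'a" where
  "unit x = \<phi> x (FObj F x) (Id D (FObj F x))"

lemma unit_hom: "x \<in> Obj C \<Longrightarrow> unit x \<in> Hom C x (FObj G (FObj F x))"
  unfolding unit_def using hom D.id_hom is_functor_obj[OF F] by blast

text \<open>The counit \<open>e\<close> is an isomorphism because precomposition with \<open>e\<close> is, up to the adjunction
  bijection, the action of \<open>G\<close> on arrows.\<close>

lemma counit_iso:
  assumes ff: "fully_faithful D C G" and y: "y \<in> Obj D"
  obtains e where "e \<in> Hom D (FObj F (FObj G y)) y" "iso_arr D e" "\<phi> (FObj G y) y e = Id C (FObj G y)"
proof -
  have Gy: "FObj G y \<in> Obj C" by (rule is_functor_obj[OF G y])
  obtain e where e: "e \<in> Hom D (FObj F (FObj G y)) y" and \<phi>e: "\<phi> (FObj G y) y e = Id C (FObj G y)"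
    using surject[OF y C.id_hom[OF Gy]] .
  have "bij_betw (\<lambda>h. Comp D h e) (Hom D y z) (Hom D (FObj F (FObj G y)) z)"
    if z: "z \<in> Obj D" for z
  proof -
    have "\<phi> (FObj G y) z (Comp D h e) = FArr G h" if h: "h \<in> Hom D y z" for h
      using natural_right[OF Gy h e] \<phi>e C.comp_id[OF is_functor_hom[OF G h]] by simp
    then have "bij_betw (\<phi> (FObj G y) z \<circ> (\<lambda>h. Comp D h e)) (Hom D y z) (Hom C (FObj G y) (FObj G z))
      \<longleftrightarrow> bij_betw (FArr G) (Hom D y z) (Hom C (FObj G y) (FObj G z))"
      by (intro bij_betw_cong) simp
    moreover have "bij_betw (FArr G) (Hom D y z) (Hom C (FObj G y) (FObj G z))"
      using ff y z unfolding fully_faithful_def by blast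
    moreover have "(\<lambda>h. Comp D h e) ` Hom D y z \<subseteq> Hom D (FObj F (FObj G y)) z"
      using D.comp_hom[OF e] by blast
    ultimately show ?thesis using bij_betw_comp_iff2[OF bij[OF Gy z]] by blast
  qed
  then have "iso_arr D e" by (rule D.iso_arr_if_precomp_bij[OF e])
  then show thesis using that e \<phi>e by blast
qed

text \<open>By a triangle identity, the image of the unit is inverse to a counit.\<close>

lemma image_of_unit_iso:
  assumes ff: "fully_faithful D C G" and x: "x \<in> Obj C"
  shows "iso_arr D (FArr F (unit x))"
proof -
  let ?y = "FObj F x"
  have y: "?y \<in> Obj D" by (rule is_functor_obj[OF F x])
  obtain e where e: "e \<in> Hom D (FObj F (FObj G ?y)) ?y" and ei: "iso_arr D e"
    and \<phi>e: "\<phi> (FObj G ?y) ?y e = Id C (FObj G ?y)"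
    by (rule counit_iso[OF ff y])
  have Fu: "FArr F (unit x) \<in> Hom D ?y (FObj F (FObj G ?y))"
    by (rule is_functor_hom[OF F unit_hom[OF x]])
  have "\<phi> x ?y (Comp D e (FArr F (unit x))) = \<phi> x ?y (Id D ?y)"
    using natural_left[OF unit_hom[OF x] e] \<phi>e C.id_comp[OF unit_hom[OF x]] by (simp add: unit_def)
  then have "Comp D e (FArr F (unit x)) = Id D ?y"
    by (rule inject[OF x D.comp_hom[OF Fu e] D.id_hom[OF y]])
  then show ?thesis by (rule D.inverse_iso_arr[OF ei e Fu])
qed

end

text \<open>The left adjoint becomes the right adjoint, with the inverse bijections.\<close>

lemma adjoint_pair_dual:
  fixes C :: "('o, 'a, 'm) ab_cat_scheme" and D :: "('p, 'b, 'n) ab_cat_scheme"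
  assumes adj: "adjoint_pair C D F G" and cat: "category C" "category D"
  shows "adjoint_pair (dual_cat D) (dual_cat C) G F"
proof -
  obtain \<phi> where "adjunction C D F G \<phi>" using adjoint_pair_obtain[OF adj cat] .
  then interpret adjunction C D F G \<phi> .
  define \<psi> where "\<psi> y x = inv_into (Hom D (FObj F x) y) (\<phi> x y)" for y x
  have psi_bij: "bij_betw (\<psi> y x) (Hom C x (FObj G y)) (Hom D (FObj F x) y)"
    if "x \<in> Obj C" "y \<in> Obj D" for x y
    unfolding \<psi>_def by (rule bij_betw_inv_into[OF bij[OF that]])
  have psi: "\<psi> y x (\<phi> x y h) = h" if "x \<in> Obj C" "h \<in> Hom D (FObj F x) y" for x y h
    unfolding \<psi>_def
    using bij_betw_inv_into_left[OF bij[OF that(1) D.Hom_obj(2)[OF that(2)]]] that(2) by blast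
  have "\<psi> y' x' (Comp C (Comp C (FArr G g) h) f) = Comp D (Comp D g (\<psi> y x h)) (FArr F f)"
    if f: "f \<in> Hom C x' x" and g: "g \<in> Hom D y y'" and h: "h \<in> Hom C x (FObj G y)"
    for x' x y y' f g h
  proof -
    have y: "y \<in> Obj D" and x': "x' \<in> Obj C" and x: "x \<in> Obj C"
      using D.Hom_obj[OF g] C.Hom_obj[OF f] by auto
    obtain l where l: "l \<in> Hom D (FObj F x) y" "\<phi> x y l = h" using surject[OF y h] .
    note lf = D.comp_hom[OF is_functor_hom[OF F f] l(1)]
    have "\<psi> y' x' (Comp C (Comp C (FArr G g) h) f) = \<psi> y' x' (Comp C (FArr G g) (Comp C h f))"
      using C.comp_assoc[OF f h is_functor_hom[OF G g]] by simp
    also have "\<dots> = \<psi> y' x' (\<phi> x' y' (Comp D g (Comp D l (FArr F f))))"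
      using natural[OF f g l(1)] l(2) by simp
    also have "\<dots> = Comp D g (Comp D l (FArr F f))" by (rule psi[OF x' D.comp_hom[OF lf g]])
    also have "\<dots> = Comp D (Comp D g (\<psi> y x h)) (FArr F f)"
      using D.comp_assoc[OF is_functor_hom[OF F f] l(1) g] psi[OF x l(1)] l(2) by simp
    finally show ?thesis .
  qed
  then show ?thesis
    unfolding adjoint_pair_def using is_functor_dual[OF F] is_functor_dual[OF G] psi_bij
    by (intro conjI exI[of _ \<psi>]) simp_all
qed

locale abelian_adjunction = adjunction C D F G \<phi> + C: abelian_category C + D: abelian_category D
  for C :: "('o, 'a, 'm) ab_cat_scheme" and D :: "('p, 'b, 'n) ab_cat_scheme" and F G \<phi>
begin

text \<open>Compatibility with zero arrows comes from limits: a right adjoint preserves terminal objects,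
  a terminal object of an abelian category is a zero object, and an arrow is zero exactly if it
  factors through one.\<close>

lemma right_zero_object:
  assumes "zero_object D z"
  shows "zero_object C (FObj G z)"
proof -
  have z: "z \<in> Obj D" using assms unfolding zero_object_def by simp
  have Gz: "FObj G z \<in> Obj C" by (rule is_functor_obj[OF G z])
  obtain f where f: "f \<in> Hom D (FObj F (FObj G z)) z" "\<phi> (FObj G z) z f = Id C (FObj G z)"
    using surject[OF z C.id_hom[OF Gz]] .
  obtain g where g: "g \<in> Hom D (FObj F (FObj G z)) z"
    "\<phi> (FObj G z) z g = Zero C (FObj G z) (FObj G z)"
    using surject[OF z C.zero_hom[OF Gz Gz]] .
  have "f = g" using D.zero_object_hom_unique(1)[OF assms] f(1) g(1) by metis
  then show ?thesis using f g Gz C.zero_object_iff by simp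
qed

lemma right_zero:
  assumes "x \<in> Obj D" "y \<in> Obj D"
  shows "FArr G (Zero D x y) = Zero C (FObj G x) (FObj G y)"
proof -
  obtain z where z: "zero_object D z" using D.ex_zero by blast
  then have zo: "z \<in> Obj D" unfolding zero_object_def by simp
  note xz = D.zero_hom[OF assms(1) zo] and zy = D.zero_hom[OF zo assms(2)]
  have "FArr G (Zero D x y) = Comp C (FArr G (Zero D z y)) (FArr G (Zero D x z))"
    using is_functor_comp[OF G xz zy] D.comp_zero[OF assms(1) zy] by simp
  also have "FArr G (Zero D x z) = Zero C (FObj G x) (FObj G z)"
    by (rule C.zero_object_hom_unique(1)[OF right_zero_object[OF z] is_functor_hom[OF G xz]])
  finally show ?thesis
    using C.comp_zero[OF is_functor_obj[OF G assms(1)] is_functor_hom[OF G zy]] by simp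
qed

lemma transpose_zero:
  assumes x: "x \<in> Obj C" and y: "y \<in> Obj D"
  shows "\<phi> x y (Zero D (FObj F x) y) = Zero C x (FObj G y)"
proof -
  have Z: "Zero D (FObj F x) y \<in> Hom D (FObj F x) y" by (rule D.zero_hom[OF is_functor_obj[OF F x] y])
  have "\<phi> x y (Comp D (Zero D y y) (Zero D (FObj F x) y))
      = Comp C (Zero C (FObj G y) (FObj G y)) (\<phi> x y (Zero D (FObj F x) y))"
    using natural_right[OF x D.zero_hom[OF y y] Z] right_zero[OF y y] by simp
  then show ?thesis
    using D.zero_comp[OF y Z] C.zero_comp[OF is_functor_obj[OF G y] hom[OF x Z]] by simp
qed

text \<open>The universal property of the kernel is transported through the bijections \<open>\<phi>\<close>, which are
  compatible with zero arrows by the preceding lemma.\<close>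

lemma right_kernel:
  assumes k: "is_kernel D f k"
  shows "is_kernel C (FArr G f) (FArr G k)"
proof -
  obtain x y z where fH: "f \<in> Hom D y z" and kH: "k \<in> Hom D x y"
    using D.is_kernel_Hom[OF k] by metis
  note Gf = is_functor_hom[OF G fH] and Gk = is_functor_hom[OF G kH]
  have o: "x \<in> Obj D" "y \<in> Obj D" "z \<in> Obj D" using D.Hom_obj[OF fH] D.Hom_obj[OF kH] by auto
  have fk: "Comp D f k = Zero D x z" and kmon: "monic D k"
    and lift: "\<And>w h. h \<in> Hom D w y \<Longrightarrow> Comp D f h = Zero D w z \<Longrightarrow> \<exists>u \<in> Hom D w x. Comp D k u = h"
    using k unfolding D.is_kernel_iff[OF fH kH] by auto
  have zero: "Comp C (FArr G f) (FArr G k) = Zero C (FObj G x) (FObj G z)"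
    using is_functor_comp[OF G kH fH] fk right_zero[OF o(1,3)] by simp
  have "u = v"
    if u: "u \<in> Hom C w (FObj G x)" and v: "v \<in> Hom C w (FObj G x)"
    and eq: "Comp C (FArr G k) u = Comp C (FArr G k) v" for w u v
  proof -
    have w: "w \<in> Obj C" using C.Hom_obj[OF u] by simp
    obtain u' where u': "u' \<in> Hom D (FObj F w) x" "\<phi> w x u' = u" using surject[OF o(1) u] .
    obtain v' where v': "v' \<in> Hom D (FObj F w) x" "\<phi> w x v' = v" using surject[OF o(1) v] .
    have "\<phi> w y (Comp D k u') = \<phi> w y (Comp D k v')"
      using natural_right[OF w kH u'(1)] natural_right[OF w kH v'(1)] u' v' eq by simp
    then have "Comp D k u' = Comp D k v'"
      by (rule inject[OF w D.comp_hom[OF u'(1) kH] D.comp_hom[OF v'(1) kH]])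
    then have "u' = v'" using kmon u'(1) v'(1) unfolding D.monic_iff[OF kH] by blast
    then show ?thesis using u' v' by simp
  qed
  then have mon: "monic C (FArr G k)" unfolding C.monic_iff[OF Gk] by blast
  have "\<exists>u \<in> Hom C w (FObj G x). Comp C (FArr G k) u = h"
    if h: "h \<in> Hom C w (FObj G y)" and fh: "Comp C (FArr G f) h = Zero C w (FObj G z)" for w h
  proof -
    have w: "w \<in> Obj C" using C.Hom_obj[OF h] by simp
    have Fw: "FObj F w \<in> Obj D" by (rule is_functor_obj[OF F w])
    obtain h' where h': "h' \<in> Hom D (FObj F w) y" "\<phi> w y h' = h" using surject[OF o(2) h] .
    have "\<phi> w z (Comp D f h') = \<phi> w z (Zero D (FObj F w) z)"
      using natural_right[OF w fH h'(1)] h'(2) fh transpose_zero[OF w o(3)] by simp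
    then have "Comp D f h' = Zero D (FObj F w) z"
      by (rule inject[OF w D.comp_hom[OF h'(1) fH] D.zero_hom[OF Fw o(3)]])
    then obtain u where u: "u \<in> Hom D (FObj F w) x" "Comp D k u = h'" using lift h'(1) by blast
    then have "Comp C (FArr G k) (\<phi> w x u) = h" using natural_right[OF w kH u(1)] h'(2) by simp
    then show ?thesis using hom[OF w u(1)] by blast
  qed
  then show ?thesis unfolding C.is_kernel_iff[OF Gf Gk] using zero mon by blast
qed

end

lemma abelian_adjunction_obtain:
  assumes "adjoint_pair C D F G" "abelian_category C" "abelian_category D"
  obtains \<phi> where "abelian_adjunction C D F G \<phi>"
proof -
  interpret C: abelian_category C by fact
  interpret D: abelian_category D by fact
  obtain \<phi> where "adjunction C D F G \<phi>"
    by (rule adjoint_pair_obtain[OF assms(1)]) unfold_locales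
  then show thesis
    using that assms(2,3) unfolding abelian_adjunction_def by blast
qed

section \<open>The image of a wide subcategory under a quotient functor\<close>

text \<open>This is the half of a recollement that involves \<open>j\<^sub>!\<close>, \<open>j\<^sup>*\<close> and \<open>j\<^sub>*\<close>, here called \<open>L\<close>, \<open>Q\<close>
  and \<open>R\<close>. The other half is represented by the assumption on the kernel of \<open>Q\<close>. These assumptions are stable under
  passing to opposite categories, which exchanges \<open>L\<close> and \<open>R\<close>.\<close>

locale quotient_of_wide = C: wide_subcategory C S + D: abelian_category D
  for C :: "('o, 'a, 'm) ab_cat_scheme" and S and D :: "('p, 'b, 'n) ab_cat_scheme" +
  fixes L :: "('p, 'b, 'o, 'a) func" and Q :: "('o, 'a, 'p, 'b) func"
    and R :: "('p, 'b, 'o, 'a) func"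
  assumes LQ: "adjoint_pair D C L Q" and QR: "adjoint_pair C D Q R"
    and ffL: "fully_faithful D C L" and ffR: "fully_faithful D C R"
    and ker: "ker_functor C D Q \<subseteq> S"
begin

abbreviation T where "T \<equiv> ess_image D Q S"

lemma dual: "quotient_of_wide (dual_cat C) S (dual_cat D) R Q L"
proof -
  have "ker_functor (dual_cat C) (dual_cat D) Q = ker_functor C D Q"
    by (simp add: ker_functor_def)
  then show ?thesis
    using C.dual abelian_dual[OF D.abelian_category_axioms] ker
      adjoint_pair_dual[OF LQ D.category_axioms C.category_axioms]
      adjoint_pair_dual[OF QR C.category_axioms D.category_axioms]
      fully_faithful_dual[OF ffL] fully_faithful_dual[OF ffR]
    by (intro quotient_of_wide.intro quotient_of_wide_axioms.intro) simp_all
qed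

lemma image_dual: "ess_image (dual_cat D) Q S = T"
  by (simp add: ess_image_def)

text \<open>\<open>Q\<close> is a right adjoint and so maps the kernel of \<open>h\<close> to a kernel of a monic arrow, which
  vanishes.\<close>

lemma kernel_mem_if_image_monic:
  assumes k: "is_kernel C h k" and mon: "monic D (FArr Q h)"
  shows "Dom C k \<in> S"
proof -
  obtain \<phi> where "abelian_adjunction D C L Q \<phi>"
    using abelian_adjunction_obtain[OF LQ D.abelian_category_axioms C.abelian_category_axioms] .
  then interpret LQ: abelian_adjunction D C L Q \<phi> .
  have kH: "k \<in> Hom C (Dom C k) (Cod C k)" by (rule C.is_kernel_Hom[OF k])
  have "zero_object D (FObj Q (Dom C k))"
    using D.kernel_of_monic_zero[OF LQ.right_kernel[OF k] mon] in_HomD[OF is_functor_hom[OF LQ.G kH]]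
    by simp
  then have "Dom C k \<in> ker_functor C D Q"
    using C.Hom_obj[OF kH] D.isomorphic_refl is_functor_obj[OF LQ.G] unfolding ker_functor_def by blast
  then show ?thesis using ker by blast
qed

lemma cokernel_mem_if_image_epic:
  assumes "is_cokernel C h c" "epic D (FArr Q h)"
  shows "Cod C c \<in> S"
  using quotient_of_wide.kernel_mem_if_image_monic[OF dual, of h c] assms by simp

text \<open>The unit at \<open>x\<close> becomes invertible under \<open>Q\<close>, so that its kernel and cokernel lie in the
  kernel of \<open>Q\<close>, hence in \<open>S\<close>.\<close>

lemma right_image_mem:
  assumes x: "x \<in> S"
  shows "FObj R (FObj Q x) \<in> S"
proof -
  obtain \<phi> where "abelian_adjunction C D Q R \<phi>"
    using abelian_adjunction_obtain[OF QR C.abelian_category_axioms D.abelian_category_axioms] .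
  then interpret QR: abelian_adjunction C D Q R \<phi> .
  have xo: "x \<in> Obj C" using x C.subset_Obj by blast
  let ?h = "QR.unit x"
  have h: "?h \<in> Hom C x (FObj R (FObj Q x))" by (rule QR.unit_hom[OF xo])
  have iso: "iso_arr D (FArr Q ?h)" by (rule QR.image_of_unit_iso[OF ffR xo])
  have mon: "monic D (FArr Q ?h)" by (rule D.iso_arr_monic[OF iso])
  have epi: "epic D (FArr Q ?h)"
    using preadditive.iso_arr_monic[OF preadditive_dual[OF D.preadditive_axioms], of "FArr Q ?h"] iso by simp
  obtain k where k: "is_kernel C ?h k" using C.ex_kernel in_HomD(1)[OF h] by blast
  obtain c where c: "is_cokernel C ?h c" using C.ex_cokernel in_HomD(1)[OF h] by blast
  show ?thesis
    by (rule C.cod_mem_if_dom_mem[OF h k c kernel_mem_if_image_monic[OF k mon]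
          cokernel_mem_if_image_epic[OF c epi] x])
qed

text \<open>One direction is the preceding lemma; the other uses that \<open>y\<close> is isomorphic to \<open>Q (R y)\<close> by
  the counit. So membership in \<open>T\<close> can be tested in \<open>S\<close>, through a functor that preserves
  kernels.\<close>

lemma image_iff_right:
  assumes y: "y \<in> Obj D"
  shows "y \<in> T \<longleftrightarrow> FObj R y \<in> S"
proof
  assume "y \<in> T"
  then obtain x where x: "x \<in> S" "isomorphic D y (FObj Q x)" unfolding ess_image_def by blast
  have "is_functor D C R" using QR unfolding adjoint_pair_def by blast
  then have "isomorphic C (FObj R (FObj Q x)) (FObj R y)"
    using is_functor_isomorphic[OF D.category_axioms] D.isomorphic_sym[OF x(2)] by blast
  then show "FObj R y \<in> S" by (rule C.isomorphic_mem[OF _ right_image_mem[OF x(1)]])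
next
  assume Ry: "FObj R y \<in> S"
  obtain \<phi> where "adjunction C D Q R \<phi>"
    using adjoint_pair_obtain[OF QR C.category_axioms D.category_axioms] .
  then interpret QR: adjunction C D Q R \<phi> .
  obtain e where "e \<in> Hom D (FObj Q (FObj R y)) y" "iso_arr D e"
    using QR.counit_iso[OF ffR y] .
  then have "isomorphic D y (FObj Q (FObj R y))"
    using D.iso_arr_imp_isomorphic D.isomorphic_sym by blast
  then show "y \<in> T" using y Ry unfolding ess_image_def by blast
qed

lemma image_iff_left:
  assumes "y \<in> Obj D"
  shows "y \<in> T \<longleftrightarrow> FObj L y \<in> S"
  using quotient_of_wide.image_iff_right[OF dual, of y] assms image_dual by simp

lemma image_kernel_mem:
  assumes k: "is_kernel D f k" and f: "Dom D f \<in> T" "Cod D f \<in> T"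
  shows "Dom D k \<in> T"
proof -
  obtain \<phi> where "abelian_adjunction C D Q R \<phi>"
    using abelian_adjunction_obtain[OF QR C.abelian_category_axioms D.abelian_category_axioms] .
  then interpret QR: abelian_adjunction C D Q R \<phi> .
  note H = D.is_kernel_Hom[OF k]
  note o = D.Hom_obj[OF H(2)] D.Hom_obj[OF H(1)]
  have "FObj R (Dom D f) \<in> S" "FObj R (Cod D f) \<in> S"
    using f image_iff_right o H(3) by simp_all
  then have "FObj R (Dom D k) \<in> S"
    using C.kernel_mem[OF QR.right_kernel[OF k]] in_HomD[OF is_functor_hom[OF QR.G H(1)]]
      in_HomD[OF is_functor_hom[OF QR.G H(2)]] H(3) by simp
  then show ?thesis using image_iff_right[OF o(1)] by simp
qed

lemma image_cokernel_mem:
  assumes "is_cokernel D f c" "Dom D f \<in> T" "Cod D f \<in> T"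
  shows "Cod D c \<in> T"
  using quotient_of_wide.image_kernel_mem[OF dual, of f c] assms image_dual by simp

text \<open>\<open>R\<close> is only left exact, but the failure of right exactness is invisible to \<open>Q\<close>. Composing the
  cokernel of \<open>R g\<close> with an arrow to some \<open>R y\<close> gives an arrow of the form \<open>R h\<close> with \<open>h \<circ> g = 0\<close>,
  so that \<open>h = 0\<close>. Applied to the unit at the cokernel object, this makes the unit zero,
  and the unit corresponds to the identity of the image of that object under \<open>Q\<close>.\<close>

lemma image_of_cokernel_zero:
  assumes g: "epic D g" and c: "is_cokernel C (FArr R g) c"
  shows "zero_object D (FObj Q (Cod C c))"
proof -
  obtain \<phi> where "abelian_adjunction C D Q R \<phi>"
    using abelian_adjunction_obtain[OF QR C.abelian_category_axioms D.abelian_category_axioms] .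
  then interpret QR: abelian_adjunction C D Q R \<phi> .
  obtain n p where gH: "g \<in> Hom D n p" using g unfolding epic_def Hom_def by blast
  note Rg = is_functor_hom[OF QR.G gH]
  have no: "n \<in> Obj D" "p \<in> Obj D" using D.Hom_obj[OF gH] by auto
  let ?q = "Cod C c"
  have cH: "c \<in> Hom C (FObj R p) ?q" and cz: "Comp C c (FArr R g) = Zero C (FObj R n) ?q"
    using c in_HomD[OF Rg] unfolding is_cokernel_def Hom_def by auto
  have qo: "?q \<in> Obj C" using C.Hom_obj[OF cH] by simp
  let ?y = "FObj Q ?q"
  have yo: "?y \<in> Obj D" by (rule is_functor_obj[OF QR.F qo])
  let ?u = "QR.unit ?q"
  have uH: "?u \<in> Hom C ?q (FObj R ?y)" by (rule QR.unit_hom[OF qo])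
  have "Comp C ?u c \<in> FArr R ` Hom D p ?y"
    using ffR no yo C.comp_hom[OF cH uH] unfolding fully_faithful_def bij_betw_def by blast
  then obtain h where h: "h \<in> Hom D p ?y" "Comp C ?u c = FArr R h" by (rule imageE)
  have "FArr R (Comp D h g) = Comp C (Comp C ?u c) (FArr R g)"
    using is_functor_comp[OF QR.G gH h(1)] h(2) by simp
  also have "\<dots> = Zero C (FObj R n) (FObj R ?y)"
    using C.comp_assoc[OF Rg cH uH] cz C.comp_zero[OF is_functor_obj[OF QR.G no(1)] uH] by simp
  also have "\<dots> = FArr R (Zero D n ?y)" using QR.right_zero[OF no(1) yo] by simp
  finally have "FArr R (Comp D h g) = FArr R (Zero D n ?y)" .
  moreover have "inj_on (FArr R) (Hom D n ?y)"
    using ffR no yo unfolding fully_faithful_def bij_betw_def by blast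
  ultimately have "Comp D h g = Zero D n ?y"
    using D.comp_hom[OF gH h(1)] D.zero_hom[OF no(1) yo] unfolding inj_on_def by blast
  then have "h = Zero D p ?y" using g h(1) unfolding D.epic_iff_trivial_null[OF gH] by blast
  then have "Comp C ?u c = Zero C (FObj R p) (FObj R ?y)"
    using h(2) QR.right_zero[OF no(2) yo] by simp
  then have "?u = Zero C ?q (FObj R ?y)"
    using C.cokernel_epic[OF c] uH unfolding C.epic_iff_trivial_null[OF cH] by blast
  then have "\<phi> ?q ?y (Id D ?y) = \<phi> ?q ?y (Zero D ?y ?y)"
    using QR.transpose_zero[OF qo yo] unfolding QR.unit_def by simp
  then have "Id D ?y = Zero D ?y ?y"
    by (rule QR.inject[OF qo D.id_hom[OF yo] D.zero_hom[OF yo yo]])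
  then show ?thesis using D.zero_object_iff yo by simp
qed

text \<open>Apply \<open>dom_mem_if_cod_mem\<close> to \<open>R g\<close>: its target and its kernel lie in \<open>S\<close> by assumption, its
  cokernel does because \<open>Q\<close> kills it.\<close>

lemma image_extension_mem:
  assumes k: "is_kernel D g f" and c: "is_cokernel D f g" and mem: "Dom D f \<in> T" "Cod D g \<in> T"
  shows "Cod D f \<in> T"
proof -
  obtain \<phi> where "abelian_adjunction C D Q R \<phi>"
    using abelian_adjunction_obtain[OF QR C.abelian_category_axioms D.abelian_category_axioms] .
  then interpret QR: abelian_adjunction C D Q R \<phi> .
  note H = D.is_kernel_Hom[OF k]
  note o = D.Hom_obj[OF H(2)] D.Hom_obj[OF H(1)]
  note Rg = is_functor_hom[OF QR.G H(1)] and Rf = is_functor_hom[OF QR.G H(2)]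
  obtain d where d: "is_cokernel C (FArr R g) d" using C.ex_cokernel in_HomD(1)[OF Rg] by blast
  have "Cod C d \<in> Obj C" using d C.cod_obj unfolding is_cokernel_def by blast
  then have "Cod C d \<in> ker_functor C D Q"
    using image_of_cokernel_zero[OF D.cokernel_epic[OF c] d] D.isomorphic_refl
      is_functor_obj[OF QR.F] unfolding ker_functor_def by blast
  then have dS: "Cod C d \<in> S" using ker by blast
  have "FObj R (Dom D f) \<in> S" "FObj R (Cod D g) \<in> S"
    using mem image_iff_right o by simp_all
  then have "FObj R (Cod D f) \<in> S"
    using C.dom_mem_if_cod_mem[OF Rg QR.right_kernel[OF k] d _ dS] in_HomD[OF Rf] by simp
  then show ?thesis using image_iff_right[OF o(2)] by simp
qed

theorem image_wide: "wide_subcat D T"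
proof -
  obtain x where x: "x \<in> S" using C.zero_object_mem by blast
  have Q: "is_functor C D Q" using QR unfolding adjoint_pair_def by blast
  have "FObj Q x \<in> Obj D" by (rule is_functor_obj[OF Q subsetD[OF C.subset_Obj x]])
  then have "FObj Q x \<in> T" using D.isomorphic_refl x unfolding ess_image_def by blast
  moreover have "T \<subseteq> Obj D" unfolding ess_image_def by blast
  ultimately show ?thesis
    unfolding D.wide_subcat_iff
    using image_kernel_mem image_cokernel_mem image_extension_mem by (intro conjI allI impI) auto
qed

end

section \<open>Restricting functors to full subcategories\<close>

lemma restrict_functor_obj: "x \<in> Obj C \<Longrightarrow> FObj (restrict_functor C F) x = FObj F x"
  by (simp add: restrict_functor_def)

lemma restrict_functor_hom: "f \<in> Hom C x y \<Longrightarrow> FArr (restrict_functor C F) f = FArr F f"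
  by (simp add: restrict_functor_def Hom_def)

lemma is_functor_restrict:
  assumes F: "is_functor C D F" and cat: "category C" and S: "S \<subseteq> Obj C"
    and ST: "\<And>x. x \<in> S \<Longrightarrow> FObj F x \<in> T"
  shows "is_functor (full_subcat C S) (full_subcat D T) (restrict_functor (full_subcat C S) F)"
proof -
  interpret S: category "full_subcat C S" by (rule category_full_subcat[OF cat S])
  let ?F = "restrict_functor (full_subcat C S) F"
  have o: "FObj ?F x = FObj F x" if "x \<in> S" for x using that restrict_functor_obj by force
  have a: "FArr ?F f = FArr F f" if "f \<in> Hom (full_subcat C S) x y" for f x y
    using restrict_functor_hom[OF that] .
  have H: "f \<in> Hom C x y" "x \<in> S" "y \<in> S" if "f \<in> Hom (full_subcat C S) x y" for f x y
    using that unfolding Hom_full_subcat by auto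
  show ?thesis
    unfolding is_functor_def full_subcat_simps
  proof (intro conjI ballI allI)
    show "FObj ?F x \<in> T" if "x \<in> S" for x using o ST that by simp
    show "FArr ?F f \<in> Hom (full_subcat D T) (FObj ?F x) (FObj ?F y)"
      if f: "f \<in> Hom (full_subcat C S) x y" for x y f
      using H[OF f] a[OF f] o ST is_functor_hom[OF F H(1)[OF f]] by (simp add: Hom_full_subcat)
    show "FArr ?F (Id C x) = Id D (FObj ?F x)" if x: "x \<in> S" for x
      using a[of "Id C x" x x] S.id_hom[of x] x o is_functor_id[OF F] S by auto
    show "FArr ?F (Comp C g f) = Comp D (FArr ?F g) (FArr ?F f)"
      if f: "f \<in> Hom (full_subcat C S) x y" and g: "g \<in> Hom (full_subcat C S) y z" for x y z f g
      using a[OF f] a[OF g] a[OF S.comp_hom[OF f g]] is_functor_comp[OF F H(1)[OF f] H(1)[OF g]]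
      by simp
  qed
qed

lemma fully_faithful_restrict:
  assumes ff: "fully_faithful C D F" and S: "S \<subseteq> Obj C"
    and ST: "\<And>x. x \<in> S \<Longrightarrow> FObj F x \<in> T"
  shows "fully_faithful (full_subcat C S) (full_subcat D T) (restrict_functor (full_subcat C S) F)"
  unfolding fully_faithful_def full_subcat_simps
proof (intro ballI)
  fix x y assume x: "x \<in> S" and y: "y \<in> S"
  let ?F = "restrict_functor (full_subcat C S) F"
  have o: "FObj ?F x = FObj F x" "FObj ?F y = FObj F y" using x y restrict_functor_obj by force+
  have Hom: "Hom (full_subcat C S) x y = Hom C x y" using x y by (simp add: Hom_full_subcat)
  have eq: "FArr ?F f = FArr F f" if "f \<in> Hom C x y" for f
    using that restrict_functor_hom[of f "full_subcat C S" x y F] unfolding Hom by blast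
  have "bij_betw (FArr F) (Hom C x y) (Hom D (FObj F x) (FObj F y))"
    using ff x y S unfolding fully_faithful_def by blast
  then have "bij_betw (FArr ?F) (Hom C x y) (Hom D (FObj F x) (FObj F y))"
    using bij_betw_cong[of "Hom C x y" "FArr ?F" "FArr F", OF eq] by blast
  then   show "bij_betw (FArr ?F) (Hom (full_subcat C S) x y)
      (Hom (full_subcat D T) (FObj ?F x) (FObj ?F y))"
    using o ST[OF x] ST[OF y] x y by (simp add: Hom_full_subcat)
qed

lemma adjoint_pair_restrict:
  assumes adj: "adjoint_pair C D F G" and cat: "category C" "category D"
    and S: "S \<subseteq> Obj C" and T: "T \<subseteq> Obj D"
    and ST: "\<And>x. x \<in> S \<Longrightarrow> FObj F x \<in> T" and TS: "\<And>y. y \<in> T \<Longrightarrow> FObj G y \<in> S"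
  shows "adjoint_pair (full_subcat C S) (full_subcat D T)
    (restrict_functor (full_subcat C S) F) (restrict_functor (full_subcat D T) G)"
proof -
  obtain \<phi> where "adjunction C D F G \<phi>" using adjoint_pair_obtain[OF adj cat] .
  then interpret adjunction C D F G \<phi> .
  let ?C = "full_subcat C S" and ?D = "full_subcat D T"
  let ?F = "restrict_functor ?C F" and ?G = "restrict_functor ?D G"
  have oF: "FObj ?F x = FObj F x" if "x \<in> S" for x using that restrict_functor_obj by force
  have oG: "FObj ?G y = FObj G y" if "y \<in> T" for y using that restrict_functor_obj by force
  have "bij_betw (\<phi> x y) (Hom ?D (FObj ?F x) y) (Hom ?C x (FObj ?G y))"
    if x: "x \<in> S" and y: "y \<in> T" for x y
    using bij[of x y] x y S T ST[OF x] TS[OF y] by (auto simp: Hom_full_subcat oF oG)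
  moreover have "\<phi> x' y' (Comp D g (Comp D h (FArr ?F f))) = Comp C (FArr ?G g) (Comp C (\<phi> x y h) f)"
    if f: "f \<in> Hom ?C x' x" and g: "g \<in> Hom ?D y y'" and h: "h \<in> Hom ?D (FObj ?F x) y"
    for x' x y y' f g h
  proof -
    have "f \<in> Hom C x' x" "g \<in> Hom D y y'" "h \<in> Hom D (FObj F x) y"
      using f g h by (auto simp: Hom_full_subcat oF)
    from natural[OF this] show ?thesis by (simp add: restrict_functor_hom[OF f] restrict_functor_hom[OF g])
  qed
  ultimately show ?thesis
    unfolding adjoint_pair_def full_subcat_simps
    using is_functor_restrict[OF F cat(1) S ST] is_functor_restrict[OF G cat(2) T TS] by blast
qed

section \<open>The restricted recollement\<close>

lemma wide_subcat_Obj: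
  assumes "abelian_category C"
  shows "wide_subcat C (Obj C)"
proof -
  interpret abelian_category C by fact
  have "Obj C \<noteq> {}" using ex_zero unfolding zero_object_def by blast
  then show ?thesis
    unfolding wide_subcat_iff
  proof (intro conjI allI impI)
    show "Dom C k \<in> Obj C" if "is_kernel C f k \<and> Dom C f \<in> Obj C \<and> Cod C f \<in> Obj C" for f k
      using that dom_obj unfolding is_kernel_def by blast
    show "Cod C c \<in> Obj C" if "is_cokernel C f c \<and> Dom C f \<in> Obj C \<and> Cod C f \<in> Obj C" for f c
      using that cod_obj unfolding is_cokernel_def by blast
    show "Cod C f \<in> Obj C"
      if "is_kernel C g f \<and> is_cokernel C f g \<and> Dom C f \<in> Obj C \<and> Cod C g \<in> Obj C" for f g
      using that cod_obj unfolding is_kernel_def by blast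
  qed simp
qed

theorem theorem1p2:
  fixes A' :: "('o1, 'a1) ab_cat" and A :: "('o, 'a) ab_cat" and A'' :: "('o2, 'a2) ab_cat"
    and i_ustar i_ushriek :: "('o, 'a, 'o1, 'a1) func"
    and i_lstar :: "('o1, 'a1, 'o, 'a) func"
    and j_ustar :: "('o, 'a, 'o2, 'a2) func"
    and j_lshriek j_lstar :: "('o2, 'a2, 'o, 'a) func"
    and S :: "'o set"
  defines "C \<equiv> full_subcat A S"
    and "C'' \<equiv> full_subcat A'' (ess_image A'' j_ustar S)"
  assumes "recollement A' A A'' i_ustar i_lstar i_ushriek j_lshriek j_ustar j_lstar"
    and "wide_subcat A S"
    and "ess_image A i_lstar (Obj A') \<subseteq> S"
  shows "wide_subcat A' (Obj A') \<and> wide_subcat A S \<and> wide_subcat A'' (ess_image A'' j_ustar S) \<and>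
    recollement A' C C''
      (restrict_functor C i_ustar) (restrict_functor A' i_lstar) (restrict_functor C i_ushriek)
      (restrict_functor C'' j_lshriek) (restrict_functor C j_ustar) (restrict_functor C'' j_lstar)"
proof -
  have ab: "abelian_category A'" "abelian_category A" "abelian_category A''"
    and ii: "adjoint_pair A A' i_ustar i_lstar" "adjoint_pair A' A i_lstar i_ushriek"
    and jj: "adjoint_pair A'' A j_lshriek j_ustar" "adjoint_pair A A'' j_ustar j_lstar"
    and ff: "fully_faithful A' A i_lstar" "fully_faithful A'' A j_lshriek" "fully_faithful A'' A j_lstar"
    and ker: "ess_image A i_lstar (Obj A') = ker_functor A A'' j_ustar"
    using assms(3) unfolding recollement_def by auto
  interpret A': abelian_category A' by (rule ab(1))
  interpret S: wide_subcategory A S by (rule wide_subcategoryI[OF assms(4)])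
  interpret A'': abelian_category A'' by (rule ab(3))
  interpret Q: quotient_of_wide A S A'' j_lshriek j_ustar j_lstar
    by unfold_locales (use jj ff ker assms(5) in auto)
  let ?T = "ess_image A'' j_ustar S"
  interpret T: wide_subcategory A'' ?T by (rule wide_subcategoryI[OF Q.image_wide])
  have fun_i: "is_functor A' A i_lstar" "is_functor A A' i_ustar" "is_functor A A' i_ushriek"
    and fun_j: "is_functor A A'' j_ustar"
    using ii jj unfolding adjoint_pair_def by auto
  \<comment> \<open>the restriction lemmas speak of two full subcategories, so \<open>A'\<close> is read as one of itself\<close>
  note full = full_subcat_Obj[OF A'.category_axioms]
  have S_obj: "x \<in> Obj A" if "x \<in> S" for x using that S.subset_Obj by blast
  have i_S: "FObj i_lstar x \<in> S" if "x \<in> Obj A'" for x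
    using that assms(5) S.isomorphic_refl is_functor_obj[OF fun_i(1)] unfolding ess_image_def by blast
  have j_T: "FObj j_ustar x \<in> ?T" if "x \<in> S" for x
    using that A''.isomorphic_refl is_functor_obj[OF fun_j S_obj] unfolding ess_image_def by blast
  have i_A': "FObj i_ustar x \<in> Obj A'" "FObj i_ushriek x \<in> Obj A'" if "x \<in> S" for x
    using that is_functor_obj[OF fun_i(2) S_obj] is_functor_obj[OF fun_i(3) S_obj] by auto
  have j_S: "FObj j_lshriek y \<in> S" "FObj j_lstar y \<in> S" if "y \<in> ?T" for y
    using that T.subset_Obj Q.image_iff_left Q.image_iff_right by blast+
  have "ess_image C (restrict_functor A' i_lstar) (Obj A')
      = ker_functor C C'' (restrict_functor C j_ustar)"
  proof -
    \<comment> \<open>isomorphisms and zero objects are the same in a wide subcategory as in the ambient category\<close>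
    have "ess_image C (restrict_functor A' i_lstar) (Obj A') = ess_image A i_lstar (Obj A')"
      unfolding ess_image_def C_def isomorphic_full_subcat
      using i_S S_obj restrict_functor_obj[of _ A' i_lstar] assms(5)[unfolded ess_image_def] by auto
    moreover have "ker_functor C C'' (restrict_functor C j_ustar) = ker_functor A A'' j_ustar \<inter> S"
    proof -
      have "(\<exists>z. zero_object C'' z \<and> isomorphic C'' (FObj (restrict_functor C j_ustar) x) z)
          \<longleftrightarrow> (\<exists>z. zero_object A'' z \<and> isomorphic A'' (FObj j_ustar x) z)" if x: "x \<in> S" for x
        using x j_T[OF x] T.isomorphic_mem[OF _ j_T[OF x]]
        unfolding C_def C''_def isomorphic_full_subcat A''.zero_object_full_subcat[OF T.subset_Obj]
        by (auto simp: restrict_functor_def)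
      then show ?thesis unfolding ker_functor_def using S_obj by (auto simp: C_def)
    qed
    ultimately show ?thesis using ker assms(5) by blast
  qed
  moreover have "adjoint_pair C A' (restrict_functor C i_ustar) (restrict_functor A' i_lstar)"
    using adjoint_pair_restrict[OF ii(1) S.category_axioms A'.category_axioms S.subset_Obj subset_refl
        i_A'(1) i_S] unfolding full C_def .
  moreover have "adjoint_pair A' C (restrict_functor A' i_lstar) (restrict_functor C i_ushriek)"
    using adjoint_pair_restrict[OF ii(2) A'.category_axioms S.category_axioms subset_refl S.subset_Obj
        i_S i_A'(2)] unfolding full C_def .
  moreover have "adjoint_pair C'' C (restrict_functor C'' j_lshriek) (restrict_functor C j_ustar)"
    unfolding C_def C''_def
    by (rule adjoint_pair_restrict[OF jj(1) A''.category_axioms S.category_axioms T.subset_Obj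
          S.subset_Obj j_S(1) j_T])
  moreover have "adjoint_pair C C'' (restrict_functor C j_ustar) (restrict_functor C'' j_lstar)"
    unfolding C_def C''_def
    by (rule adjoint_pair_restrict[OF jj(2) S.category_axioms A''.category_axioms S.subset_Obj
          T.subset_Obj j_T j_S(2)])
  moreover have "fully_faithful A' C (restrict_functor A' i_lstar)"
    using fully_faithful_restrict[OF ff(1) subset_refl i_S] unfolding full C_def .
  moreover have "fully_faithful C'' C (restrict_functor C'' j_lshriek)"
    "fully_faithful C'' C (restrict_functor C'' j_lstar)"
    unfolding C_def C''_def
    using fully_faithful_restrict[OF ff(2) T.subset_Obj j_S(1)]
      fully_faithful_restrict[OF ff(3) T.subset_Obj j_S(2)] by auto
  moreover have "abelian_category C" "abelian_category C''"
    unfolding C_def C''_def using S.abelian_full_subcat T.abelian_full_subcat by auto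
  ultimately show ?thesis
    unfolding recollement_def
    using ab(1) wide_subcat_Obj[OF ab(1)] assms(4) Q.image_wide by blast
qed

end
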